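(* Let $\rho_0:\mathbb{N}\to[0,\infty)$ satisfy $m_1(\rho_0)=\sum_{j=1}^\infty j\rho_0(j)=m\in\left(0,\frac12\right)$ and $m_2(\rho_0)=\sum_{j=1}^\infty j^2\rho_0(j)<+\infty$. Consider the discrete Coagulation-Fragmentation equation with kernels $a(j,k)=jk$ and $b(j,k)=1$. Then there exists a unique mass-conserving solution $\rho:\mathbb{N}\times[0,\infty)\to[0,\infty)$ with $\rho(\cdot,0)=\rho_0$.
   Context: Here $\mathbb{N}=\{1,2,3,\dots\}$. The discrete Coagulation-Fragmentation equation with kernels $a(j,k)=jk$, $b(j,k)=1$ and initial data $\rho_0$ is, for $j\in\mathbb{N}$, $t>0$, $$\rho_t(j,t)=\frac12\sum_{k=1}^{j-1}(j-k)k\,\rho(j-k,t)\rho(k,t)-\rho(j,t)\sum_{k=1}^\infty jk\,\rho(k,t)-\frac12(j-1)\rho(j,t)+\sum_{k=1}^\infty\rho(j+k,t),\qquad \rho(j,0)=\rho_0(j).$$ A function $\rho:\mathbb{N}\times[0,\infty)\to[0,\infty)$ is called a solution if $\rho(\cdot,0)=\rho_0$ and for every bounded $g:\mathbb{N}\to\mathbb{R}$, $$\frac{d}{dt}\sum_{j=1}^\infty g(j)\rho(j,t)=\frac12\sum_{j=1}^\infty\sum_{k=1}^\infty\big(g(j+k)-g(j)-g(k)\big)jk\,\rho(j,t)\rho(k,t)-\frac12\sum_{j=1}^\infty\sum_{k=1}^{j-1}\big(g(j)-g(k)-g(j-k)\big)\rho(j,t).$$ The solution is mass-conserving if $m_1(t)=\sum_{j=1}^\infty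 j\rho(j,t)$ equals $m_1(\rho_0)$ for all $t\ge0$. *)

theory Defs
  imports "HOL-Analysis.Analysis"
begin

text \<open>The positive integers are the subset \<open>{1..}\<close> of \<^typ>\<open>nat\<close>; no definition below looks at
  the values of a sequence at \<open>0\<close>.\<close>

definition finite_moment :: "nat \<Rightarrow> (nat \<Rightarrow> real) \<Rightarrow> bool" where
  "finite_moment p f \<longleftrightarrow> (\<lambda>j. real j ^ p * f j) summable_on {1..}"

definition moment :: "nat \<Rightarrow> (nat \<Rightarrow> real) \<Rightarrow> real" where
  "moment p f = (\<Sum>\<^sub>\<infinity>j\<in>{1..}. real j ^ p * f j)"

definition coag_term :: "(nat \<Rightarrow> nat \<Rightarrow> real) \<Rightarrow> (nat \<Rightarrow> real) \<Rightarrow> (nat \<Rightarrow> real) \<Rightarrow> nat \<Rightarrow> nat \<Rightarrow> real" where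
  "coag_term a g f j k = (g (j + k) - g j - g k) * a j k * f j * f k"

definition frag_term :: "(nat \<Rightarrow> nat \<Rightarrow> real) \<Rightarrow> (nat \<Rightarrow> real) \<Rightarrow> (nat \<Rightarrow> real) \<Rightarrow> nat \<Rightarrow> real" where
  "frag_term b g f j = (\<Sum>k\<in>{1..<j}. (g j - g k - g (j - k)) * b k (j - k) * f j)"

text \<open>A solution is defined through the weak form of the equation, for every bounded test
  sequence \<open>g\<close>. As \<^const>\<open>infsum\<close> returns \<open>0\<close> for a divergent family, convergence of all the
  series involved is required explicitly. The derivative at time \<open>0\<close> is one-sided.
  Membership in \<open>\<rightarrow>\<^sub>E\<close> fixes \<open>\<rho>\<close> outside \<open>{1..} \<times> {0..}\<close>, so that equality of solutions
  means equality of functions on that domain.\<close>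

definition cf_solution ::
  "(nat \<Rightarrow> nat \<Rightarrow> real) \<Rightarrow> (nat \<Rightarrow> nat \<Rightarrow> real) \<Rightarrow> (nat \<Rightarrow> real) \<Rightarrow> (nat \<times> real \<Rightarrow> real) \<Rightarrow> bool" where
  "cf_solution a b \<rho>0 \<rho> \<longleftrightarrow>
     \<rho> \<in> {1..} \<times> {0..} \<rightarrow>\<^sub>E {0..} \<and>
     (\<forall>j\<ge>1. \<rho> (j, 0) = \<rho>0 j) \<and>
     (\<forall>g. bounded (g ` {1..}) \<longrightarrow>
        (\<forall>t\<ge>0.
           (\<lambda>j. g j * \<rho> (j, t)) summable_on {1..} \<and>
           (\<lambda>(j, k). coag_term a g (\<lambda>i. \<rho> (i, t)) j k) summable_on {1..} \<times> {1..} \<and>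
           frag_term b g (\<lambda>i. \<rho> (i, t)) summable_on {1..} \<and>
           ((\<lambda>s. \<Sum>\<^sub>\<infinity>j\<in>{1..}. g j * \<rho> (j, s)) has_real_derivative
              (1/2) * (\<Sum>\<^sub>\<infinity>j\<in>{1..}. \<Sum>\<^sub>\<infinity>k\<in>{1..}. coag_term a g (\<lambda>i. \<rho> (i, t)) j k)
              - (1/2) * (\<Sum>\<^sub>\<infinity>j\<in>{1..}. frag_term b g (\<lambda>i. \<rho> (i, t)) j))
             (at t within {0..})))"

definition mass_conserving :: "(nat \<Rightarrow> real) \<Rightarrow> (nat \<times> real \<Rightarrow> real) \<Rightarrow> bool" where
  "mass_conserving \<rho>0 \<rho> \<longleftrightarrow>
     (\<forall>t\<ge>0. finite_moment 1 (\<lambda>j. \<rho> (j, t)) \<and> moment 1 (\<lambda>j. \<rho> (j, t)) = moment 1 \<rho>0)"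

end

theory Submission
  imports Defs "HOL-Complex_Analysis.Great_Picard"
begin

text \<open>Testing the equation with \<open>1 - z ^ j\<close> turns it into the local Hamilton-Jacobi equation
  \<open>F\<^sub>t = - P\<^sup>2 / 2 - P / 2 + m - (1 / (1 - z) - 1 / 2) F\<close> for \<open>F = \<Sum>\<^sub>j (1 - z ^ j) \<rho>\<^sub>j\<close>, where
  \<open>P = m + z F\<^sub>z\<close> is nonnegative. The difference of two solutions of equal mass is transported
  out of \<open>z < z\<^sub>0\<close> across \<open>z = z\<^sub>0\<close> and damped, so a maximum principle on \<open>[0, z\<^sub>0] \<times> [0, T]\<close> gives uniqueness.

  For existence, put \<open>z = exp (- x)\<close> and \<open>H(x) = \<Sum>\<^sub>j (j x - 1 + exp (- j x)) \<rho>\<^sub>j\<close>. Then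
  \<open>H\<^sub>t \<le> H\<^sub>x\<^sup>2 / 2 + H\<^sub>x / 2 - H / x + m x / 2\<close>, and \<open>0 \<le> H\<^sub>x \<le> m \<le> 1/2\<close> bounds the first two terms
  by \<open>3/4 H\<^sub>x\<close>. As \<open>(3/4)(5/4) < 1\<close>, the bound \<open>H \<le> A x powr (5/4)\<close> persists in time. It survives
  truncation to clusters of size at most \<open>N\<close> and the explicit Euler scheme with step of order \<open>N\<^sup>-\<^sup>2\<close>, because
  convexity of \<open>H\<close> replaces \<open>H\<^sub>x\<close> by the forward difference quotient. The barrier gives tails of the
  mass that are uniformly small in time and in \<open>N\<close>, so a limit of the Euler approximations is a
  mass-conserving solution.\<close>

section \<open>The truncated Euler scheme\<close>

text \<open>For \<open>1 - z ^ j\<close> and for \<open>real j * x - 1 + z ^ j\<close> the defect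
  \<open>g j - g k - g (j - k)\<close> is, up to sign, the product summed here, because linear terms
  cancel. Expanding it leaves two geometric sums, so the identity evaluates the fragmentation term
  in both the uniqueness and the existence argument.\<close>

lemma sum_fragment_products:
  fixes z :: real
  assumes "z \<noteq> 1" "j \<ge> 1"
  shows "(\<Sum>k\<in>{1..<j}. (1 - z ^ k) * (1 - z ^ (j - k)))
    = 2 * real j - (real j - 1) * (1 - z ^ j) - 2 * (1 - z ^ j) / (1 - z)"
proof -
  have geo: "(\<Sum>k\<in>{1..<j}. z ^ k) = (1 - z ^ j) / (1 - z) - 1"
  proof -
    have "(\<Sum>k<j. z ^ k) = (\<Sum>k\<in>{1..<j}. z ^ k) + 1"
      using assms(2) by (simp add: lessThan_atLeast0 sum.atLeast_Suc_lessThan)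
    moreover have "(\<Sum>k<j. z ^ k) = (1 - z ^ j) / (1 - z)"
      using sum_gp_strict[of z j] assms(1) by simp
    ultimately show ?thesis by linarith
  qed
  have rev: "(\<Sum>k\<in>{1..<j}. z ^ (j - k)) = (\<Sum>k\<in>{1..<j}. z ^ k)"
    by (rule sum.reindex_bij_witness[where i = "\<lambda>k. j - k" and j = "\<lambda>k. j - k"]) auto
  have "(\<Sum>k\<in>{1..<j}. (1 - z ^ k) * (1 - z ^ (j - k)))
      = (\<Sum>k\<in>{1..<j}. (1 + z ^ j) - z ^ k - z ^ (j - k))"
    by (rule sum.cong) (auto simp: algebra_simps simp flip: power_add)
  also have "\<dots> = (real j - 1) * (1 + z ^ j) - 2 * ((1 - z ^ j) / (1 - z) - 1)"
    unfolding sum_subtractf rev geo using assms(2) by (simp add: of_nat_diff diff_divide_distrib)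
  finally show ?thesis by (simp add: algebra_simps diff_divide_distrib)
qed

text \<open>Suppressing exactly the mergers that would leave \<open>{1..N}\<close> closes the system
  on finitely many sizes and still conserves mass.\<close>

definition trunc_kernel :: "nat \<Rightarrow> nat \<Rightarrow> nat \<Rightarrow> real" where
  "trunc_kernel N j k = (if j + k \<le> N then real j * real k else 0)"

text \<open>The range \<open>n\<close> is independent of the kernel: \<open>n = N\<close> gives the
  full truncated right-hand side, and \<open>n = R < N\<close> gives its heads, in which the limit
  can be taken term by term.\<close>

definition weak_rhs :: "(nat \<Rightarrow> nat \<Rightarrow> real) \<Rightarrow> nat \<Rightarrow> (nat \<Rightarrow> real) \<Rightarrow> (nat \<Rightarrow> real) \<Rightarrow> real" where
  "weak_rhs a n g f = 1/2 * (\<Sum>(j, k)\<in>{1..n} \<times> {1..n}. coag_term a g f j k)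
     - 1/2 * (\<Sum>j\<in>{1..n}. frag_term (\<lambda>j k. 1) g f j)"

text \<open>Linearity lets any test sequence be expanded in indicator sequences, which links the
  componentwise Euler step to its weak form.\<close>

lemma weak_rhs_sum:
  "weak_rhs a n (\<lambda>j. \<Sum>i\<in>I. c i * G i j) f = (\<Sum>i\<in>I. c i * weak_rhs a n (G i) f)"
proof -
  have 1: "coag_term a (\<lambda>j. \<Sum>i\<in>I. c i * G i j) f j k = (\<Sum>i\<in>I. c i * coag_term a (G i) f j k)" for j k
    by (simp add: coag_term_def sum_distrib_left sum_distrib_right sum_subtractf sum.distrib algebra_simps)
  have p: "(\<Sum>k\<in>K. (\<Sum>i\<in>I. c i * G i j) - (\<Sum>i\<in>I. c i * G i k) - (\<Sum>i\<in>I. c i * G i (j - k)))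
     = (\<Sum>i\<in>I. c i * (\<Sum>k\<in>K. G i j - G i k - G i (j - k)))" for j K
    by (subst sum_distrib_left, subst sum.swap) (simp add: sum_subtractf sum.distrib algebra_simps)
  have 2: "frag_term (\<lambda>j k. 1) (\<lambda>j. \<Sum>i\<in>I. c i * G i j) f j
     = (\<Sum>i\<in>I. c i * frag_term (\<lambda>j k. 1) (G i) f j)" for j
    unfolding frag_term_def mult_1_right sum_distrib_right[symmetric] p
    by (subst sum_distrib_right) (simp add: mult.assoc)
  have 3: "(\<Sum>x\<in>S. \<Sum>i\<in>I. c i * F i x) = (\<Sum>i\<in>I. c i * (\<Sum>x\<in>S. F i x))" for F :: "_ \<Rightarrow> 'x \<Rightarrow> real" and S
    by (subst sum.swap) (simp add: sum_distrib_left)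
  show ?thesis
    unfolding weak_rhs_def 1 2 case_prod_beta 3
    by (simp add: sum_distrib_left right_diff_distrib sum_subtractf mult_ac)
qed

lemma weak_rhs_cong:
  assumes "\<And>j. j \<in> {1..N} \<Longrightarrow> g j = h j"
  shows "weak_rhs (trunc_kernel N) N g f = weak_rhs (trunc_kernel N) N h f"
proof -
  have 1: "coag_term (trunc_kernel N) g f j k = coag_term (trunc_kernel N) h f j k"
    if "j \<in> {1..N}" "k \<in> {1..N}" for j k
    using that assms[of j] assms[of k] assms[of "j + k"] by (auto simp: coag_term_def trunc_kernel_def)
  have 2: "frag_term (\<lambda>j k. 1) g f j = frag_term (\<lambda>j k. 1) h f j" if "j \<in> {1..N}" for j
    unfolding frag_term_def using that by (intro sum.cong arg_cong2[where f = "(*)"] arg_cong2[where f = "(-)"] assms refl) auto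
  show ?thesis
    unfolding weak_rhs_def
    by (intro arg_cong2[where f = "(-)"] arg_cong2[where f = "(*)"] sum.cong refl) (auto simp: 1 2)
qed

lemma sum_square_factor:
  fixes u v :: "nat \<Rightarrow> real"
  shows "(\<Sum>(j, k)\<in>A \<times> B. u j * v k) = sum u A * sum v B"
  by (simp add: sum_product sum.cartesian_product)

text \<open>Here and in \<open>frag_term_bound\<close> the terms are measured by mass: the kernel
  \<open>j k\<close> turns a pair into a product of two mass terms, and a fragmentation sum has
  fewer than \<open>j\<close> entries. The factor 3 counts the values of \<open>g\<close>
  involved.\<close>

lemma coag_term_bound:
  assumes "j \<ge> 1" "k \<ge> 1" "\<And>i. i \<ge> 1 \<Longrightarrow> \<bar>g i\<bar> \<le> B" "\<And>i. i \<ge> 1 \<Longrightarrow> f i \<ge> 0"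
    "\<bar>a j k\<bar> \<le> real j * real k"
  shows "\<bar>coag_term a g f j k\<bar> \<le> 3 * B * ((real j * f j) * (real k * f k))"
proof -
  have "\<bar>g (j + k) - g j - g k\<bar> \<le> 3 * B"
    using assms(3)[of j] assms(3)[of k] assms(3)[of "j + k"] assms(1,2) by auto
  then have "\<bar>g (j + k) - g j - g k\<bar> * \<bar>a j k\<bar> \<le> 3 * B * (real j * real k)"
    by (rule mult_mono) (use assms(5) assms(3)[of j] assms(1) in auto)
  then have "\<bar>g (j + k) - g j - g k\<bar> * \<bar>a j k\<bar> * (f j * f k) \<le> 3 * B * (real j * real k) * (f j * f k)"
    by (rule mult_right_mono) (use assms in auto)
  then show ?thesis
    using assms by (simp add: coag_term_def abs_mult mult_ac)
qed

lemma frag_term_bound: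
  assumes "j \<ge> 1" "\<And>i. i \<ge> 1 \<Longrightarrow> \<bar>g i\<bar> \<le> B" "\<And>i. i \<ge> 1 \<Longrightarrow> f i \<ge> 0"
  shows "\<bar>frag_term (\<lambda>j k. 1) g f j\<bar> \<le> 3 * B * (real j * f j)"
proof -
  have B: "B \<ge> 0" using assms(2)[of 1] by auto
  have "\<bar>frag_term (\<lambda>j k. 1) g f j\<bar> \<le> (\<Sum>k\<in>{1..<j}. \<bar>(g j - g k - g (j - k)) * 1 * f j\<bar>)"
    unfolding frag_term_def by (rule sum_abs)
  also have "\<dots> \<le> (\<Sum>k\<in>{1..<j}. 3 * B * f j)"
  proof (rule sum_mono)
    fix k assume "k \<in> {1..<j}"
    then have "k \<ge> 1" "j - k \<ge> 1" by auto
    then have "\<bar>g j - g k - g (j - k)\<bar> \<le> 3 * B"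
      using assms(2)[of j] assms(2)[of k] assms(2)[of "j - k"] assms(1) by linarith
    then show "\<bar>(g j - g k - g (j - k)) * 1 * f j\<bar> \<le> 3 * B * f j"
      using assms(1,3) by (auto simp: abs_mult intro!: mult_right_mono)
  qed
  also have "\<dots> = (real j - 1) * (3 * B * f j)"
    using assms(1) by (simp add: of_nat_diff)
  also have "\<dots> \<le> real j * (3 * B * f j)"
    using B assms by (intro mult_right_mono) auto
  finally show ?thesis by (simp add: mult_ac)
qed

text \<open>With mass at most 1/2 the two parts contribute at most \<open>3/8 * B\<close> and
  \<open>3/4 * B\<close>. The rounded constant 2 becomes the Lipschitz constant of the scheme in
  time.\<close>

lemma weak_rhs_bound:
  assumes g: "\<And>i. i \<ge> 1 \<Longrightarrow> \<bar>g i\<bar> \<le> B" and f: "\<And>i. i \<ge> 1 \<Longrightarrow> f i \<ge> 0"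
    and a: "\<And>j k. \<bar>a j k\<bar> \<le> real j * real k" and M: "(\<Sum>j=1..n. real j * f j) \<le> 1/2"
  shows "\<bar>weak_rhs a n g f\<bar> \<le> 2 * B"
proof -
  have B: "B \<ge> 0" using g[of 1] by auto
  let ?M = "\<Sum>j=1..n. real j * f j"
  have M0: "?M \<ge> 0" by (intro sum_nonneg) (use f in auto)
  have "\<bar>\<Sum>(j, k)\<in>{1..n} \<times> {1..n}. coag_term a g f j k\<bar>
      \<le> (\<Sum>(j, k)\<in>{1..n} \<times> {1..n}. 3 * B * ((real j * f j) * (real k * f k)))"
    by (rule order.trans[OF sum_abs sum_mono]) (auto intro!: coag_term_bound g f a)
  also have "\<dots> = 3 * B * (?M * ?M)"
    unfolding sum_square_factor[symmetric] by (simp add: sum_distrib_left case_prod_beta)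
  also have "\<dots> \<le> 3 * B * (1/2 * (1/2))"
    by (intro mult_left_mono mult_mono) (use M M0 B in auto)
  finally have 1: "\<bar>\<Sum>(j, k)\<in>{1..n} \<times> {1..n}. coag_term a g f j k\<bar> \<le> 3/4 * B" by simp
  have "\<bar>\<Sum>j=1..n. frag_term (\<lambda>j k. 1) g f j\<bar> \<le> (\<Sum>j=1..n. 3 * B * (real j * f j))"
    by (rule order.trans[OF sum_abs sum_mono]) (auto intro!: frag_term_bound g f)
  also have "\<dots> = 3 * B * ?M" by (simp add: sum_distrib_left)
  also have "\<dots> \<le> 3 * B * (1/2)" by (intro mult_left_mono) (use M B in auto)
  finally have 2: "\<bar>\<Sum>j=1..n. frag_term (\<lambda>j k. 1) g f j\<bar> \<le> 3/2 * B" by simp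
  show ?thesis unfolding weak_rhs_def using 1 2 B by (simp add: abs_if split: if_splits)
qed

section \<open>The explicit Euler step: weak form, mass and positivity\<close>

definition euler_step :: "nat \<Rightarrow> real \<Rightarrow> (nat \<Rightarrow> real) \<Rightarrow> nat \<Rightarrow> real" where
  "euler_step N d f i =
     (if i \<in> {1..N} then f i + d * weak_rhs (trunc_kernel N) N (\<lambda>j. of_bool (j = i)) f else 0)"

text \<open>All sums are finite, so \<open>g\<close> may grow: the identity is applied to
  \<open>real\<close> for the mass and to the convex weight for the barrier.\<close>

lemma sum_euler_step:
  "(\<Sum>i=1..N. g i * euler_step N d f i)
     = (\<Sum>i=1..N. g i * f i) + d * weak_rhs (trunc_kernel N) N g f"
proof -
  have "weak_rhs (trunc_kernel N) N g f
      = weak_rhs (trunc_kernel N) N (\<lambda>j. \<Sum>i=1..N. g i * of_bool (j = i)) f"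
    by (rule weak_rhs_cong) (simp add: sum.delta' of_bool_def if_distrib cong: if_cong)
  also have "\<dots> = (\<Sum>i=1..N. g i * weak_rhs (trunc_kernel N) N (\<lambda>j. of_bool (j = i)) f)"
    by (rule weak_rhs_sum)
  finally show ?thesis
    by (simp add: euler_step_def distrib_left sum.distrib sum_distrib_left mult_ac)
qed

lemma sum_mass_euler_step:
  "(\<Sum>i=1..N. real i * euler_step N d f i) = (\<Sum>i=1..N. real i * f i)"
proof -
  have "frag_term (\<lambda>j k. 1) real f j = 0" for j
    unfolding frag_term_def by (intro sum.neutral) (auto simp: of_nat_diff)
  then have "weak_rhs (trunc_kernel N) N real f = 0"
    by (simp add: weak_rhs_def coag_term_def case_prod_beta)
  then show ?thesis using sum_euler_step[of real] by simp
qed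

text \<open>Only losses can destroy the sign. With mass at most 1/2, size \<open>i\<close> loses at
  most \<open>i * f i / 2\<close> by coagulation and the same by fragmentation, so
  \<open>d * real N <= 1\<close> prevents overshooting zero.\<close>

lemma euler_step_nonneg:
  assumes f: "\<And>i. i \<ge> 1 \<Longrightarrow> f i \<ge> 0" and M: "(\<Sum>j=1..N. real j * f j) \<le> 1/2"
    and d: "d \<ge> 0" "d * real N \<le> 1"
  shows "euler_step N d f i \<ge> 0"
proof (cases "i \<in> {1..N}")
  case i: True
  let ?M = "\<Sum>j=1..N. real j * f j"
  let ?e = "\<lambda>j. of_bool (j = i) :: real"
  have fi: "f i \<ge> 0" using f i by auto
  have e: "(\<Sum>j=1..N. ?e j * (real j * f j)) = real i * f i"
    using i by (simp add: of_bool_def if_distrib if_distribR cong: if_cong)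
  \<comment> \<open>The gain \<open>?e (j + k)\<close> is dropped, and the loss is counted for each
    of the two partners.\<close>
  have "- (\<Sum>(j, k)\<in>{1..N} \<times> {1..N}. coag_term (trunc_kernel N) ?e f j k)
      \<le> (\<Sum>(j, k)\<in>{1..N} \<times> {1..N}. (?e j * (real j * f j)) * (real k * f k) + (real j * f j) * (?e k * (real k * f k)))"
    unfolding sum_negf[symmetric]
  proof (rule sum_mono, clarify)
    fix j k assume jk: "j \<in> {1..N}" "k \<in> {1..N}"
    have "- (?e (j + k) - ?e j - ?e k) * trunc_kernel N j k \<le> (?e j + ?e k) * (real j * real k)"
      by (intro mult_mono) (auto simp: trunc_kernel_def)
    then have "- (?e (j + k) - ?e j - ?e k) * trunc_kernel N j k * (f j * f k)
       \<le> (?e j + ?e k) * (real j * real k) * (f j * f k)"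
      by (rule mult_right_mono) (use jk f in auto)
    then show "- coag_term (trunc_kernel N) ?e f j k
      \<le> ?e j * (real j * f j) * (real k * f k) + real j * f j * (?e k * (real k * f k))"
      by (simp add: coag_term_def algebra_simps)
  qed
  also have "\<dots> = 2 * (real i * f i * ?M)"
    unfolding case_prod_beta sum.distrib sum_square_factor[unfolded case_prod_beta, of "\<lambda>j. ?e j * (real j * f j)" "\<lambda>k. real k * f k"]
      sum_square_factor[unfolded case_prod_beta, of "\<lambda>k. real k * f k" "\<lambda>j. ?e j * (real j * f j)"] e
    by simp
  also have "\<dots> \<le> 2 * (real i * f i * (1/2))"
    by (intro mult_left_mono M) (use fi in auto)
  finally have 1: "- (\<Sum>(j, k)\<in>{1..N} \<times> {1..N}. coag_term (trunc_kernel N) ?e f j k) \<le> real i * f i"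
    by simp
  have "(\<Sum>j=1..N. frag_term (\<lambda>j k. 1) ?e f j) \<le> (\<Sum>j=1..N. ?e j * (real j * f j))"
  proof (rule sum_mono)
    fix j assume j: "j \<in> {1..N}"
    then have fj: "f j \<ge> 0" using f by auto
    have "frag_term (\<lambda>j k. 1) ?e f j \<le> (\<Sum>k\<in>{1..<j}. ?e j * f j)"
      unfolding frag_term_def by (intro sum_mono mult_right_mono fj) auto
    also have "\<dots> \<le> ?e j * (real j * f j)"
      using fj by (auto intro!: mult_right_mono)
    finally show "frag_term (\<lambda>j k. 1) ?e f j \<le> ?e j * (real j * f j)" .
  qed
  then have 2: "(\<Sum>j=1..N. frag_term (\<lambda>j k. 1) ?e f j) \<le> real i * f i"
    by (simp only: e)
  have "weak_rhs (trunc_kernel N) N ?e f \<ge> - (real i * f i)"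
    unfolding weak_rhs_def using 1 2 by linarith
  then have "d * weak_rhs (trunc_kernel N) N ?e f \<ge> d * - (real i * f i)"
    by (rule mult_left_mono) (rule d)
  moreover have "d * real i * f i \<le> 1 * f i"
  proof (rule mult_right_mono[OF _ fi])
    show "d * real i \<le> 1"
      by (rule order.trans[OF mult_left_mono d(2)]) (use i d in auto)
  qed
  ultimately show ?thesis using i by (simp add: euler_step_def)
qed (auto simp: euler_step_def)

section \<open>The barrier for the convex transform\<close>

text \<open>Split the exponent as \<open>1 + 1/4\<close> and bound the fourth root by Bernoulli. The
  product stays unexpanded because its factor \<open>1 + u\<close> combines exactly with
  \<open>1 - d\<close> in \<open>barrier_step_factor\<close>.\<close>

lemma powr_barrier_shift:
  fixes x u :: real
  assumes "x > 0" "u \<ge> 0"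
  shows "(x + u * x) powr (5/4) \<le> x powr (5/4) * ((1 + u) * (1 + u / 4))"
proof -
  have "1 + u \<le> (1 + u / 4) ^ 4"
    using Bernoulli_inequality[of "u / 4" 4] assms by simp
  then have "(1 + u) powr (1/4) \<le> ((1 + u / 4) ^ 4) powr (1/4)"
    by (rule powr_mono2[rotated 2]) (use assms in auto)
  also have "(1 + u / 4) ^ 4 = (1 + u / 4) powr 4"
    using assms by (subst powr_numeral) auto
  also have "\<dots> powr (1/4) = 1 + u / 4" using assms by (simp only: powr_powr) simp
  finally have "(1 + u) powr (1/4) \<le> 1 + u / 4" .
  moreover have "(1 + u) powr (5/4) = (1 + u) * (1 + u) powr (1/4)"
    using assms powr_add[of "1 + u" 1 "1/4"] by simp
  ultimately have "(1 + u) powr (5/4) \<le> (1 + u) * (1 + u / 4)"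
    using assms by (simp add: mult_left_mono)
  moreover have "(x + u * x) powr (5/4) = x powr (5/4) * (1 + u) powr (5/4)"
    using assms by (subst powr_mult[symmetric]) (auto simp: algebra_simps)
  ultimately show ?thesis
    by (simp add: mult_left_mono)
qed

text \<open>This is the discrete form of \<open>(3/4) (5/4) < 1\<close>. To first order the product
  is \<open>1 - d + 15/16 * d = 1 - d / 16\<close>, and for \<open>d\<close> up to 1/12 half of this
  margin remains.\<close>

lemma barrier_step_factor:
  fixes d u :: real
  assumes "0 \<le> d" "d \<le> 1/12" "u = 3/4 * d / (1 - d)"
  shows "(1 - d) * ((1 + u) * (1 + u / 4)) \<le> 1 - d / 32"
proof -
  have "(1 - d) * (1 + u) = 1 - d / 4" using assms by (simp add: field_simps)
  moreover have u: "u \<le> 9/11 * d"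
  proof -
    have "u \<le> 3/4 * d / (11/12)" unfolding assms(3) using assms by (intro divide_left_mono) auto
    then show ?thesis by simp
  qed
  ultimately have "(1 - d) * ((1 + u) * (1 + u / 4)) = (1 - d / 4) * (1 + u / 4)"
    by (simp add: mult.assoc[symmetric])
  also have "\<dots> \<le> (1 - d / 4) * (1 + 9/44 * d)"
    using u assms(1,2) by (intro mult_left_mono) auto
  also have "\<dots> \<le> 1 - d / 32"
    using assms(1,2) by (simp add: algebra_simps)
  finally show ?thesis .
qed

section \<open>The convex transform and its differential inequality\<close>

definition convex_moment :: "nat \<Rightarrow> (nat \<Rightarrow> real) \<Rightarrow> real \<Rightarrow> real" where
  "convex_moment N f x = (\<Sum>j=1..N. (real j * x - 1 + exp (- x) ^ j) * f j)"

text \<open>This is the derivative of \<open>convex_moment\<close> in \<open>x\<close>. As an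
  explicit sum it enters only through termwise inequalities.\<close>

definition slope_moment :: "nat \<Rightarrow> (nat \<Rightarrow> real) \<Rightarrow> real \<Rightarrow> real" where
  "slope_moment N f x = (\<Sum>j=1..N. (real j * (1 - exp (- x) ^ j)) * f j)"

text \<open>The coagulation defect of the convex weight is \<open>(1 - z ^ j) * (1 - z ^ k)\<close>,
  which is nonnegative, so truncating the kernel only lowers this part and the squared slope stays
  an upper bound. In the fragmentation part \<open>1 / (1 - z)\<close> is replaced by
  \<open>1 / x + 1\<close>, and the leftover is covered by the last term.\<close>

lemma weak_rhs_convex_moment_le:
  assumes f: "\<And>i. i \<ge> 1 \<Longrightarrow> f i \<ge> 0" and x: "x > 0"
  shows "weak_rhs (trunc_kernel N) N (\<lambda>j. real j * x - 1 + exp (- x) ^ j) f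
    \<le> 1/2 * (slope_moment N f x)\<^sup>2 + 1/2 * slope_moment N f x - convex_moment N f x / x
      + x / 2 * (\<Sum>j=1..N. real j * f j)"
proof -
  define z where "z = exp (- x)"
  have z: "0 < z" "z < 1" using x by (auto simp: z_def)
  have zp: "z ^ j \<le> 1" for j using z by (simp add: power_le_one)
  let ?g = "\<lambda>j. real j * x - 1 + z ^ j"
  let ?p = "\<lambda>j. (real j * (1 - z ^ j)) * f j"
  have inv: "1 / (1 - z) \<le> 1 / x + 1"
  proof -
    have "1 + x \<le> exp x" by simp
    then have "z \<le> 1 / (1 + x)"
      using x unfolding z_def exp_minus by (auto simp: field_simps)
    then have "1 - z \<ge> x / (1 + x)" using x by (simp add: field_simps)
    then have "1 / (1 - z) \<le> 1 / (x / (1 + x))"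
      using x by (intro divide_left_mono) (auto simp: z)
    then show ?thesis using x by (simp add: field_simps)
  qed
  have zx: "1 - z ^ j \<le> real j * x" for j
  proof -
    have "1 - real j * x \<le> exp (- (real j * x))" using exp_ge_add_one_self[of "- (real j * x)"] by simp
    also have "\<dots> = z ^ j" by (simp add: z_def flip: exp_of_nat_mult)
    finally show ?thesis by simp
  qed
  have "(\<Sum>(j, k)\<in>{1..N} \<times> {1..N}. coag_term (trunc_kernel N) ?g f j k)
     \<le> (\<Sum>(j, k)\<in>{1..N} \<times> {1..N}. ?p j * ?p k)"
  proof (rule sum_mono, clarify)
    fix j k assume jk: "j \<in> {1..N}" "k \<in> {1..N}"
    have "?g (j + k) - ?g j - ?g k = (1 - z ^ j) * (1 - z ^ k)"
      by (simp add: algebra_simps power_add)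
    then have "coag_term (trunc_kernel N) ?g f j k
        = ((1 - z ^ j) * (1 - z ^ k) * (f j * f k)) * trunc_kernel N j k"
      by (simp add: coag_term_def)
    also have "\<dots> \<le> ((1 - z ^ j) * (1 - z ^ k) * (f j * f k)) * (real j * real k)"
      by (rule mult_left_mono) (use f jk zp in \<open>auto simp: trunc_kernel_def\<close>)
    finally show "coag_term (trunc_kernel N) ?g f j k \<le> ?p j * ?p k" by (simp add: mult_ac)
  qed
  also have "\<dots> = (slope_moment N f x)\<^sup>2"
    unfolding sum_square_factor slope_moment_def z_def power2_eq_square ..
  finally have 1: "(\<Sum>(j, k)\<in>{1..N} \<times> {1..N}. coag_term (trunc_kernel N) ?g f j k)
    \<le> (slope_moment N f x)\<^sup>2" .
  have 2: "2 / x * (?g j * f j) - ?p j - x * (real j * f j) \<le> frag_term (\<lambda>j k. 1) ?g f j" if j: "j \<in> {1..N}" for j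
  proof -
    have fj: "f j \<ge> 0" using f j by auto
    have "(\<Sum>k\<in>{1..<j}. ?g j - ?g k - ?g (j - k)) = (\<Sum>k\<in>{1..<j}. (1 - z ^ k) * (1 - z ^ (j - k)))"
      by (rule sum.cong) (auto simp: algebra_simps of_nat_diff simp flip: power_add)
    also have "\<dots> = 2 * real j - (real j - 1) * (1 - z ^ j) - 2 * (1 - z ^ j) * (1 / (1 - z))"
      using sum_fragment_products[of z j] z j by simp
    also have "\<dots> \<ge> 2 * real j - (real j - 1) * (1 - z ^ j) - 2 * (1 - z ^ j) * (1 / x + 1)"
      using inv zp[of j] by (intro diff_left_mono mult_left_mono) auto
    \<comment> \<open>Reading \<open>2 * j\<close> as \<open>(2 / x) * (j * x)\<close> recombines
      the terms into a multiple of the weight itself; this is the source of the damping term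
      \<open>- H / x\<close>.\<close>
    moreover have "2 * real j - (real j - 1) * (1 - z ^ j) - 2 * (1 - z ^ j) * (1 / x + 1)
       = 2 / x * ?g j - real j * (1 - z ^ j) - (1 - z ^ j)"
      using x by (simp add: field_simps)
    ultimately have "2 / x * ?g j - real j * (1 - z ^ j) - x * real j \<le> (\<Sum>k\<in>{1..<j}. ?g j - ?g k - ?g (j - k))"
      using zx[of j] by (simp add: mult.commute)
    then have "(2 / x * ?g j - real j * (1 - z ^ j) - x * real j) * f j
       \<le> (\<Sum>k\<in>{1..<j}. ?g j - ?g k - ?g (j - k)) * f j"
      by (rule mult_right_mono) (rule fj)
    also have "\<dots> = frag_term (\<lambda>j k. 1) ?g f j"
      unfolding frag_term_def mult_1_right sum_distrib_right ..
    also have "(2 / x * ?g j - real j * (1 - z ^ j) - x * real j) * f j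
       = 2 / x * (?g j * f j) - ?p j - x * (real j * f j)"
      by (simp only: left_diff_distrib[of "2 / x * ?g j - real j * (1 - z ^ j)"] left_diff_distrib[of "2 / x * ?g j"] mult.assoc)
    finally show ?thesis .
  qed
  have "(\<Sum>j=1..N. 2 / x * (?g j * f j) - ?p j - x * (real j * f j)) \<le> (\<Sum>j=1..N. frag_term (\<lambda>j k. 1) ?g f j)"
    by (rule sum_mono) (rule 2)
  then have "2 / x * convex_moment N f x - slope_moment N f x - x * (\<Sum>j=1..N. real j * f j)
     \<le> (\<Sum>j=1..N. frag_term (\<lambda>j k. 1) ?g f j)"
    unfolding convex_moment_def slope_moment_def z_def[symmetric] sum_subtractf sum_distrib_left .
  with 1 show ?thesis
    unfolding weak_rhs_def z_def[symmetric] by simp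
qed

text \<open>The transform is convex in \<open>x\<close>, and this is its tangent line inequality. It
  trades the slope, on which the barrier gives no direct information, for a value of the transform
  at a shifted point.\<close>

lemma slope_moment_le:
  assumes f: "\<And>i. i \<ge> 1 \<Longrightarrow> f i \<ge> 0"
  shows "s * slope_moment N f x \<le> convex_moment N f (x + s) - convex_moment N f x"
proof -
  have "convex_moment N f (x + s) - convex_moment N f x - s * slope_moment N f x
      = (\<Sum>j=1..N. exp (- x) ^ j * (exp (- s) ^ j - (1 - real j * s)) * f j)"
    unfolding convex_moment_def slope_moment_def sum_distrib_left sum_subtractf[symmetric]
    by (rule sum.cong) (auto simp: algebra_simps exp_add exp_diff exp_minus power_mult_distrib divide_inverse)
  also have "\<dots> \<ge> 0"
  proof (rule sum_nonneg)
    fix j assume j: "j \<in> {1..N}"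
    have "1 - real j * s \<le> exp (- (real j * s))" using exp_ge_add_one_self[of "- (real j * s)"] by simp
    also have "\<dots> = exp (- s) ^ j" by (simp flip: exp_of_nat_mult)
    finally show "0 \<le> exp (- x) ^ j * (exp (- s) ^ j - (1 - real j * s)) * f j"
      using f j by auto
  qed
  finally show ?thesis by simp
qed

lemma convex_weight_le:
  assumes "(y::real) \<ge> 0"
  shows "y - 1 + exp (- y) \<le> y" "y - 1 + exp (- y) \<le> y\<^sup>2 / 2" "0 \<le> y - 1 + exp (- y)"
proof -
  show "y - 1 + exp (- y) \<le> y" using assms by simp
  show "0 \<le> y - 1 + exp (- y)" using exp_ge_add_one_self[of "- y"] by simp
  have "exp (- y) + y - y\<^sup>2 / 2 \<le> exp (- 0) + 0 - 0\<^sup>2 / 2"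
  proof (rule DERIV_nonpos_imp_nonincreasing[OF assms, of "\<lambda>y. exp (- y) + y - y\<^sup>2 / 2"])
    fix v :: real
    have "((\<lambda>y. exp (- y) + y - y\<^sup>2 / 2) has_real_derivative - exp (- v) + 1 - v) (at v)"
      by (auto intro!: derivative_eq_intros)
    moreover have "- exp (- v) + 1 - v \<le> 0" using exp_ge_add_one_self[of "- v"] by simp
    ultimately show "\<exists>w. ((\<lambda>y. exp (- y) + y - y\<^sup>2 / 2) has_real_derivative w) (at v) \<and> w \<le> 0"
      by blast
  qed
  then show "y - 1 + exp (- y) \<le> y\<^sup>2 / 2" by simp
qed

text \<open>The linear bound serves for \<open>x\<close> at least 1, where the mass suffices; the
  quadratic one serves for small \<open>x\<close>.\<close>

lemma convex_moment_le:
  assumes f: "\<And>i. i \<ge> 1 \<Longrightarrow> f i \<ge> 0" and x: "x \<ge> 0"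
  shows "convex_moment N f x \<le> x * (\<Sum>j=1..N. real j * f j)"
    and "convex_moment N f x \<le> x\<^sup>2 / 2 * (\<Sum>j=1..N. (real j)\<^sup>2 * f j)"
proof -
  have e: "exp (- x) ^ j = exp (- (real j * x))" for j by (simp flip: exp_of_nat_mult)
  show "convex_moment N f x \<le> x * (\<Sum>j=1..N. real j * f j)"
    unfolding convex_moment_def sum_distrib_left e
  proof (rule sum_mono)
    fix j assume "j \<in> {1..N}"
    then show "(real j * x - 1 + exp (- (real j * x))) * f j \<le> x * (real j * f j)"
      using mult_right_mono[OF convex_weight_le(1)[of "real j * x"], of "f j"] x f[of j] by (auto simp: mult_ac)
  qed
  show "convex_moment N f x \<le> x\<^sup>2 / 2 * (\<Sum>j=1..N. (real j)\<^sup>2 * f j)"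
    unfolding convex_moment_def sum_distrib_left e
  proof (rule sum_mono)
    fix j assume "j \<in> {1..N}"
    then show "(real j * x - 1 + exp (- (real j * x))) * f j \<le> x\<^sup>2 / 2 * ((real j)\<^sup>2 * f j)"
      using mult_right_mono[OF convex_weight_le(2)[of "real j * x"], of "f j"] x f[of j]
      by (auto simp: power_mult_distrib mult_ac)
  qed
qed

text \<open>For \<open>x >= 1\<close> and for \<open>x <= 1 / N\<^sup>2\<close> the barrier follows
  from the mass alone, in the latter case because the second moment is at most \<open>N\<close>
  times the mass. Only the range between uses the dynamics, and there the choice of \<open>d\<close>
  makes \<open>d / x\<close> at most 1/12.\<close>

lemma convex_moment_euler_step:
  assumes f: "\<And>i. i \<ge> 1 \<Longrightarrow> f i \<ge> 0" and M: "(\<Sum>j=1..N. real j * f j) \<le> 1/2"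
    and N: "N \<ge> 1" and d: "d = 1 / (12 * (real N)\<^sup>2)" and A: "A \<ge> 8"
    and bar: "\<And>x. x > 0 \<Longrightarrow> convex_moment N f x \<le> A * x powr (5/4)" and x: "x > 0"
  shows "convex_moment N (euler_step N d f) x \<le> A * x powr (5/4)"
proof -
  let ?f' = "euler_step N d f"
  let ?M = "\<Sum>j=1..N. real j * f j"
  have d0: "d > 0" using N by (simp add: d)
  have dN: "d * real N \<le> 1" using N by (simp add: d power2_eq_square field_simps)
  have f': "?f' i \<ge> 0" for i
    using euler_step_nonneg[OF f M _ dN] d0 by simp
  have M': "(\<Sum>j=1..N. real j * ?f' j) \<le> 1/2" using M by (simp only: sum_mass_euler_step)
  consider "x \<ge> 1" | "x \<le> 1 / (real N)\<^sup>2" | "x \<le> 1" "1 / (real N)\<^sup>2 \<le> x" by linarith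
  then show ?thesis
  proof cases
    case 1
    have "convex_moment N ?f' x \<le> x * (\<Sum>j=1..N. real j * ?f' j)"
      by (rule convex_moment_le) (use f' x in auto)
    also have "\<dots> \<le> x * (1/2)" by (rule mult_left_mono[OF M']) (use x in auto)
    also have "\<dots> \<le> A * x" using x A by (simp add: mult.commute)
    also have "\<dots> \<le> A * x powr (5/4)"
      using powr_mono[of 1 "5/4" x] 1 A by auto
    finally show ?thesis .
  next
    case 2
    have "sqrt x \<le> sqrt (1 / (real N)\<^sup>2)" using 2 by simp
    then have s: "real N * sqrt x \<le> 1" using N by (simp add: real_sqrt_divide field_simps)
    have x1: "x \<le> 1" using 2 N by (smt (verit) divide_le_eq_1 one_le_power real_of_nat_ge_one_iff)
    have "convex_moment N ?f' x \<le> x\<^sup>2 / 2 * (\<Sum>j=1..N. (real j)\<^sup>2 * ?f' j)"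
      by (rule convex_moment_le) (use f' x in auto)
    also have "(\<Sum>j=1..N. (real j)\<^sup>2 * ?f' j) \<le> (\<Sum>j=1..N. real N * (real j * ?f' j))"
      unfolding power2_eq_square mult.assoc by (intro sum_mono mult_right_mono) (use f' in auto)
    also have "\<dots> \<le> real N * (1/2)"
      unfolding sum_distrib_left[symmetric] by (rule mult_left_mono[OF M']) auto
    finally have "convex_moment N ?f' x \<le> x\<^sup>2 / 4 * real N" using x by (simp add: mult_left_mono)
    also have "x\<^sup>2 = x powr (3/2) * sqrt x"
      using x by (simp add: powr_half_sqrt[symmetric] powr_add[symmetric])
    also have "x powr (3/2) * sqrt x / 4 * real N \<le> x powr (3/2) / 4"
      using mult_left_mono[OF s, of "x powr (3/2) / 4"] x by (simp add: mult_ac)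
    also have "x powr (3/2) \<le> x powr (5/4)" using x x1 by (intro powr_mono') auto
    also have "x powr (5/4) / 4 \<le> A * x powr (5/4)"
      using A mult_right_mono[of "1/4" A "x powr (5/4)"] by simp
    finally show ?thesis by simp
  next
    case 3
    define D where "D = d / x"
    \<comment> \<open>This shift cancels the terms in \<open>H(x)\<close>: the step becomes \<open>(1 - D) h(x + s) + d x / 4\<close>.\<close>
    define u where "u = 3/4 * D / (1 - D)"
    define s where "s = u * x"
    have D: "0 < D" "D \<le> 1/12"
    proof -
      show "0 < D" using d0 x by (simp add: D_def)
      have "d * 12 \<le> x" using 3 N by (simp add: d)
      then show "D \<le> 1/12" using x by (simp add: D_def field_simps)
    qed
    then have u: "u > 0" by (simp add: u_def)
    then have s: "s > 0" using x by (simp add: s_def)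
    let ?P = "slope_moment N f x" and ?H = "convex_moment N f x"
    let ?h = "\<lambda>x. A * x powr (5/4)"
    have P0: "?P \<ge> 0" unfolding slope_moment_def
      by (intro sum_nonneg mult_nonneg_nonneg) (use f x in \<open>auto simp: power_le_one\<close>)
    have "?P \<le> ?M" unfolding slope_moment_def
    proof (rule sum_mono)
      fix i assume i: "i \<in> {1..N}"
      have "real i * (1 - exp (- x) ^ i) \<le> real i * 1" by (intro mult_left_mono) auto
      then show "real i * (1 - exp (- x) ^ i) * f i \<le> real i * f i" using i f
        by (intro mult_right_mono) auto
    qed
    with M have P1: "?P \<le> 1/2" by simp
    \<comment> \<open>Mass at most 1/2 fixes the rate here: \<open>P\<^sup>2 / 2 + P / 2\<close> is
      at most \<open>3/4 * P\<close>.\<close>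
    have P2: "?P\<^sup>2 \<le> 1/2 * ?P" unfolding power2_eq_square by (rule mult_right_mono[OF P1 P0])
    have "convex_moment N ?f' x = ?H + d * weak_rhs (trunc_kernel N) N (\<lambda>j. real j * x - 1 + exp (- x) ^ j) f"
      unfolding convex_moment_def by (rule sum_euler_step)
    also have "\<dots> \<le> ?H + d * (1/2 * ?P\<^sup>2 + 1/2 * ?P - ?H / x + x / 2 * ?M)"
      by (intro add_left_mono mult_left_mono weak_rhs_convex_moment_le f x less_imp_le[OF d0])
    also have "\<dots> \<le> ?H + d * (3/4 * ?P - ?H / x + x / 4)"
    proof (intro add_left_mono mult_left_mono)
      have "x / 2 * ?M \<le> x / 2 * (1/2)" by (rule mult_left_mono[OF M]) (use x in auto)
      then show "1/2 * ?P\<^sup>2 + 1/2 * ?P - ?H / x + x / 2 * ?M \<le> 3/4 * ?P - ?H / x + x / 4"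
        using P2 by linarith
    qed (use d0 in auto)
    also have "\<dots> = ?H + (3/4 * d) * ?P - D * ?H + d * x / 4"
      by (simp add: D_def algebra_simps)
    also have "(3/4 * d) * ?P = (1 - D) * (s * ?P)"
    proof -
      have "(1 - D) * u = 3/4 * D" using D by (simp add: u_def field_simps)
      then have "(1 - D) * s = 3/4 * (D * x)" by (simp only: s_def mult.assoc[symmetric])
      also have "D * x = d" using x by (simp add: D_def)
      finally have "(1 - D) * s = 3/4 * d" .
      then show ?thesis unfolding mult.assoc[symmetric] by simp
    qed
    also have "\<dots> \<le> (1 - D) * (?h (x + s) - ?H)"
      using slope_moment_le[where f = f and s = s and N = N and x = x, OF f] bar[of "x + s"] x s D by (intro mult_left_mono) auto
    also have "?H + (1 - D) * (?h (x + s) - ?H) - D * ?H + d * x / 4 = (1 - D) * ?h (x + s) + d * x / 4"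
      by (simp add: algebra_simps)
    also have "?h (x + s) \<le> A * (x powr (5/4) * ((1 + u) * (1 + u / 4)))"
      unfolding s_def using powr_barrier_shift[OF x, of u] u A by (intro mult_left_mono) auto
    then have "(1 - D) * ?h (x + s) \<le> ?h x * ((1 - D) * ((1 + u) * (1 + u / 4)))"
      using mult_left_mono[of "?h (x + s)" "A * (x powr (5/4) * ((1 + u) * (1 + u / 4)))" "1 - D"] D
      by (simp add: mult_ac)
    also have "\<dots> \<le> ?h x * (1 - D / 32)"
      by (intro mult_left_mono barrier_step_factor) (use D A in \<open>auto simp: u_def\<close>)
    also have "\<dots> = ?h x - D / 32 * (A * x powr (5/4))" by (simp add: algebra_simps)
    \<comment> \<open>The source \<open>d * x / 4\<close> is absorbed by the remaining margin:
      \<open>A >= 8\<close> and \<open>x <= 1\<close> make that margin at least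
      \<open>D * x\<^sup>2 / 4\<close>, which equals it.\<close>
    also have "D / 32 * (A * x powr (5/4)) \<ge> D / 32 * (8 * x\<^sup>2)"
    proof (intro mult_left_mono mult_mono)
      have "x powr 2 \<le> x powr (5/4)" using x 3 by (intro powr_mono') auto
      then show "x\<^sup>2 \<le> x powr (5/4)" using x by simp
    qed (use D A in auto)
    then have "?h x - D / 32 * (A * x powr (5/4)) \<le> ?h x - d * x / 4"
      using x by (simp add: D_def power2_eq_square)
    finally show ?thesis by simp
  qed
qed

section \<open>Uniform tails and equicontinuity\<close>

text \<open>The remainder of a dominated series is controlled by the remainder of its majorant. In
  the applications \<open>w\<close> is a mass density or a product of two, so every truncation error
  becomes a mass tail; \<open>F = {}\<close> gives the plain comparison test.\<close>

lemma infsum_subset_approx: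
  fixes c w :: "'x \<Rightarrow> real"
  assumes w: "w summable_on S" and c: "\<And>x. x \<in> S \<Longrightarrow> \<bar>c x\<bar> \<le> C * w x" and F: "F \<subseteq> S"
  shows "c summable_on S" "\<bar>infsum c S - infsum c F\<bar> \<le> C * (infsum w S - infsum w F)"
proof -
  have Cw: "(\<lambda>x. C * w x) summable_on S" by (rule summable_on_cmult_right[OF w])
  have abs: "(\<lambda>x. norm (c x)) summable_on S"
    by (rule summable_on_comparison_test[OF Cw]) (use c in auto)
  then show c': "c summable_on S" by (rule abs_summable_summable)
  have S: "S = F \<union> (S - F)" using F by auto
  have sub: "v summable_on S \<Longrightarrow> infsum v S = infsum v F + infsum v (S - F)" for v :: "'x \<Rightarrow> real"
    by (subst S, subst infsum_Un_disjoint) (auto intro: summable_on_subset_banach[OF _ F] summable_on_subset_banach)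
  have "infsum c S - infsum c F = infsum c (S - F)"
    using sub[OF c'] by simp
  also have "\<bar>\<dots>\<bar> \<le> infsum (\<lambda>x. \<bar>c x\<bar>) (S - F)"
    using norm_infsum_bound[OF summable_on_subset_banach[OF abs, of "S - F"]] by simp
  also have "\<dots> \<le> infsum (\<lambda>x. C * w x) (S - F)"
    by (rule infsum_mono) (use c summable_on_subset_banach[OF abs] summable_on_subset_banach[OF Cw] in auto)
  also have "\<dots> = C * (infsum w S - infsum w F)"
    using sub[OF w] by (simp add: infsum_cmult_right')
  finally show "\<bar>infsum c S - infsum c F\<bar> \<le> C * (infsum w S - infsum w F)" .
qed

lemma sum_subset_approx:
  fixes c w :: "'x \<Rightarrow> real"
  assumes "finite S" "\<And>x. x \<in> S \<Longrightarrow> \<bar>c x\<bar> \<le> C * w x" "F \<subseteq> S"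
  shows "\<bar>sum c S - sum c F\<bar> \<le> C * (sum w S - sum w F)"
  using infsum_subset_approx(2)[of w S c C F] assms finite_subset[OF assms(3,1)] by simp

definition mult_kernel :: "nat \<Rightarrow> nat \<Rightarrow> real" where
  "mult_kernel j k = real j * real k"

abbreviation mass_upto :: "nat \<Rightarrow> (nat \<Rightarrow> real) \<Rightarrow> real" where
  "mass_upto n f \<equiv> \<Sum>j=1..n. real j * f j"

lemma mass_upto_mono:
  assumes "\<And>i. i \<ge> 1 \<Longrightarrow> f i \<ge> 0" "R \<le> N"
  shows "mass_upto R f \<le> mass_upto N f"
  by (rule sum_mono2) (use assms in auto)

lemma square_diff_le:
  fixes a b :: real
  assumes "0 \<le> a" "a \<le> b" "b \<le> 1/2"
  shows "b * b - a * a \<le> b - a"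
proof -
  have "(b - a) * (b + a) \<le> (b - a) * 1" using assms by (intro mult_left_mono) auto
  then show ?thesis by (simp add: algebra_simps)
qed

text \<open>The pairs outside the square of side \<open>R\<close> carry the difference of the
  squared masses. As the masses are at most 1/2, this is at most the difference of the masses
  themselves, so a small tail permits replacing the right-hand side by a finite head.\<close>

lemma weak_rhs_head_approx:
  assumes g: "\<And>i. i \<ge> 1 \<Longrightarrow> \<bar>g i\<bar> \<le> B" and f: "\<And>i. i \<ge> 1 \<Longrightarrow> f i \<ge> 0"
    and a: "\<And>j k. \<bar>a j k\<bar> \<le> real j * real k" and M: "mass_upto N f \<le> 1/2" and R: "R \<le> N"
  shows "\<bar>weak_rhs a N g f - weak_rhs a R g f\<bar> \<le> 3 * B * (mass_upto N f - mass_upto R f)"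
proof -
  have B: "B \<ge> 0" using g[of 1] by auto
  have mono: "mass_upto R f \<le> mass_upto N f" by (rule mass_upto_mono[OF f R])
  have M0: "mass_upto R f \<ge> 0" by (intro sum_nonneg) (use f in auto)
  have "\<bar>(\<Sum>(j, k)\<in>{1..N} \<times> {1..N}. coag_term a g f j k) - (\<Sum>(j, k)\<in>{1..R} \<times> {1..R}. coag_term a g f j k)\<bar>
     \<le> 3 * B * ((\<Sum>(j, k)\<in>{1..N} \<times> {1..N}. (real j * f j) * (real k * f k))
        - (\<Sum>(j, k)\<in>{1..R} \<times> {1..R}. (real j * f j) * (real k * f k)))"
    by (rule sum_subset_approx) (use R in \<open>auto intro!: coag_term_bound g f a\<close>)
  also have "\<dots> \<le> 3 * B * (mass_upto N f - mass_upto R f)"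
    unfolding sum_square_factor
    by (intro mult_left_mono square_diff_le) (use M M0 mono B in auto)
  finally have 1: "\<bar>(\<Sum>(j, k)\<in>{1..N} \<times> {1..N}. coag_term a g f j k)
      - (\<Sum>(j, k)\<in>{1..R} \<times> {1..R}. coag_term a g f j k)\<bar> \<le> 3 * B * (mass_upto N f - mass_upto R f)" .
  have 2: "\<bar>(\<Sum>j=1..N. frag_term (\<lambda>j k. 1) g f j) - (\<Sum>j=1..R. frag_term (\<lambda>j k. 1) g f j)\<bar>
     \<le> 3 * B * (mass_upto N f - mass_upto R f)"
    by (rule sum_subset_approx) (use R in \<open>auto intro!: frag_term_bound g f\<close>)
  show ?thesis unfolding weak_rhs_def using 1 2 by linarith
qed

text \<open>Two sizes up to \<open>R\<close> never merge beyond \<open>2 * R\<close>, so the head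
  does not see the truncation.\<close>

lemma weak_rhs_trunc_kernel:
  "2 * R \<le> N \<Longrightarrow> weak_rhs (trunc_kernel N) R g f = weak_rhs mult_kernel R g f"
  unfolding weak_rhs_def
  by (intro arg_cong2[where f = "(-)"] arg_cong2[where f = "(*)"] sum.cong refl)
    (auto simp: coag_term_def trunc_kernel_def mult_kernel_def)

text \<open>A head is a polynomial in finitely many components. The crude power of \<open>R\<close>
  is harmless because \<open>R\<close> stays fixed while time differences shrink.\<close>

lemma weak_rhs_Lipschitz:
  assumes g: "\<And>i. i \<ge> 1 \<Longrightarrow> \<bar>g i\<bar> \<le> B"
    and f: "\<And>i. i \<in> {1..R} \<Longrightarrow> \<bar>f i\<bar> \<le> 1" and f': "\<And>i. i \<in> {1..R} \<Longrightarrow> \<bar>f' i\<bar> \<le> 1"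
    and a: "\<And>j k. \<bar>a j k\<bar> \<le> real j * real k"
    and e: "\<And>i. i \<in> {1..R} \<Longrightarrow> \<bar>f i - f' i\<bar> \<le> e"
  shows "\<bar>weak_rhs a R g f - weak_rhs a R g f'\<bar> \<le> 6 * B * real R ^ 4 * e"
proof (cases "R = 0")
  case False
  have B: "B \<ge> 0" using g[of 1] by auto
  have e0: "e \<ge> 0" using e[of 1] False by auto
  have "\<bar>\<Sum>(j, k)\<in>{1..R} \<times> {1..R}. coag_term a g f j k - coag_term a g f' j k\<bar>
     \<le> (\<Sum>(j, k)\<in>{1..R} \<times> {1..R}. (3 * B) * (real R * real R) * (2 * e))"
    unfolding case_prod_beta
  proof (rule order.trans[OF sum_abs sum_mono])
    fix x assume x: "x \<in> {1..R} \<times> {1..R}"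
    define j k where "j = fst x" and "k = snd x"
    have jk: "1 \<le> j" "j \<le> R" "1 \<le> k" "k \<le> R" using x by (auto simp: j_def k_def)
    have "f j * f k - f' j * f' k = (f j - f' j) * f k + f' j * (f k - f' k)" by (simp add: algebra_simps)
    also have "\<bar>\<dots>\<bar> \<le> \<bar>f j - f' j\<bar> * \<bar>f k\<bar> + \<bar>f' j\<bar> * \<bar>f k - f' k\<bar>"
      by (rule order.trans[OF abs_triangle_ineq]) (simp add: abs_mult)
    also have "\<dots> \<le> e * 1 + 1 * e"
      using jk by (intro add_mono mult_mono f f' e e0) auto
    finally have ff: "\<bar>f j * f k - f' j * f' k\<bar> \<le> 2 * e" by simp
    have gg: "\<bar>g (j + k) - g j - g k\<bar> \<le> 3 * B"
      using g[of j] g[of k] g[of "j + k"] jk by auto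
    have "real j * real k \<le> real R * real R" using jk by (intro mult_mono) auto
    then have aa: "\<bar>a j k\<bar> \<le> real R * real R" using a[of j k] by simp
    have "\<bar>coag_term a g f j k - coag_term a g f' j k\<bar>
       = \<bar>g (j + k) - g j - g k\<bar> * \<bar>a j k\<bar> * \<bar>f j * f k - f' j * f' k\<bar>"
      unfolding abs_mult[symmetric] by (simp add: coag_term_def algebra_simps)
    also have "\<dots> \<le> (3 * B) * (real R * real R) * (2 * e)"
      by (intro mult_mono gg aa ff) (use B in auto)
    finally show "\<bar>coag_term a g f (fst x) (snd x) - coag_term a g f' (fst x) (snd x)\<bar>
        \<le> 3 * B * (real R * real R) * (2 * e)"
      by (simp add: j_def k_def)
  qed
  also have "\<dots> = 6 * B * real R ^ 4 * e"
    by (simp add: power4_eq_xxxx)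
  finally have 1: "\<bar>(\<Sum>(j, k)\<in>{1..R} \<times> {1..R}. coag_term a g f j k)
      - (\<Sum>(j, k)\<in>{1..R} \<times> {1..R}. coag_term a g f' j k)\<bar> \<le> 6 * B * real R ^ 4 * e"
    by (simp add: case_prod_beta sum_subtractf)
  have "\<bar>\<Sum>j=1..R. frag_term (\<lambda>j k. 1) g f j - frag_term (\<lambda>j k. 1) g f' j\<bar> \<le> (\<Sum>j=1..R. real R * (3 * B * e))"
  proof (rule order.trans[OF sum_abs sum_mono])
    fix j assume j: "j \<in> {1..R}"
    have "\<bar>frag_term (\<lambda>j k. 1) g f j - frag_term (\<lambda>j k. 1) g f' j\<bar>
        = \<bar>\<Sum>k\<in>{1..<j}. (g j - g k - g (j - k)) * (f j - f' j)\<bar>"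
      by (simp add: frag_term_def algebra_simps flip: sum_subtractf)
    also have "\<dots> \<le> (\<Sum>k\<in>{1..<j}. 3 * B * e)"
    proof (rule order.trans[OF sum_abs sum_mono])
      fix k assume k: "k \<in> {1..<j}"
      then have "j \<ge> 1" "k \<ge> 1" "j - k \<ge> 1" by auto
      then have "\<bar>g j - g k - g (j - k)\<bar> \<le> 3 * B"
        using g[of j] g[of k] g[of "j - k"] by linarith
      then show "\<bar>(g j - g k - g (j - k)) * (f j - f' j)\<bar> \<le> 3 * B * e"
        unfolding abs_mult using e[OF j] B by (intro mult_mono) auto
    qed
    also have "\<dots> \<le> real R * (3 * B * e)"
      using j B e0 by (auto intro!: mult_right_mono)
    finally show "\<bar>frag_term (\<lambda>j k. 1) g f j - frag_term (\<lambda>j k. 1) g f' j\<bar> \<le> real R * (3 * B * e)" .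
  qed
  also have "\<dots> = real R ^ 2 * (3 * B * e)" by (simp add: power2_eq_square)
  also have "\<dots> \<le> real R ^ 4 * (6 * B * e)"
    using False B e0 by (intro mult_mono power_increasing) auto
  finally have 2: "\<bar>(\<Sum>j=1..R. frag_term (\<lambda>j k. 1) g f j) - (\<Sum>j=1..R. frag_term (\<lambda>j k. 1) g f' j)\<bar>
     \<le> 6 * B * real R ^ 4 * e"
    by (simp add: sum_subtractf mult_ac)
  show ?thesis unfolding weak_rhs_def using 1 2 by linarith
qed (simp add: weak_rhs_def)

section \<open>Mass tails from the barrier\<close>

lemma convex_weight_ge:
  assumes "(y::real) \<ge> 2"
  shows "y - 1 + exp (- y) \<ge> y / 2"
  using assms exp_gt_zero[of "- y"] by linarith

text \<open>This is the barrier \<open>A * x powr (5/4)\<close> at \<open>x = 2 / R\<close>, divided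
  by \<open>x / 2\<close>.\<close>

definition tail_bound :: "real \<Rightarrow> nat \<Rightarrow> real" where
  "tail_bound A R = 2 * A * (2 / real R) powr (1/4)"

lemma tail_bound_tendsto: "tail_bound A \<longlonglongrightarrow> 0"
proof -
  have "(\<lambda>R. (2 / real R) powr (1/4)) \<longlonglongrightarrow> 0 powr (1/4)"
    by (rule tendsto_powr') (auto intro!: tendsto_intros real_tendsto_divide_at_top filterlim_real_sequentially)
  from tendsto_mult_left[OF this, of "2 * A"] show ?thesis
    by (simp add: tail_bound_def[abs_def])
qed

text \<open>A Chebyshev argument: at \<open>x = 2 / R\<close> every \<open>j > R\<close> has
  \<open>j * x >= 2\<close>, where the convex weight is at least half its linear part. The bound
  vanishes for large \<open>R\<close> because the barrier exponent exceeds 1.\<close>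

lemma mass_tail_le:
  assumes f: "\<And>i. i \<ge> 1 \<Longrightarrow> f i \<ge> 0" and A: "A \<ge> 0"
    and bar: "\<And>x. x > 0 \<Longrightarrow> convex_moment N f x \<le> A * x powr (5/4)" and R: "1 \<le> R" "R \<le> N"
  shows "mass_upto N f - mass_upto R f \<le> tail_bound A R"
proof -
  define x where "x = 2 / real R"
  have x: "x > 0" using R by (simp add: x_def)
  have e: "exp (- x) ^ j = exp (- (real j * x))" for j by (simp flip: exp_of_nat_mult)
  let ?w = "\<lambda>j. (real j * x - 1 + exp (- x) ^ j) * f j"
  have sub: "{1..N} = {1..R} \<union> {R<..N}" using R by auto
  have split: "sum v {1..N} = sum v {1..R} + sum v {R<..N}" for v :: "nat \<Rightarrow> real"
    unfolding sub by (rule sum.union_disjoint) auto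
  have nn: "?w j \<ge> 0" if "j \<ge> 1" for j
    unfolding e using x f[OF that] convex_weight_le(3)[of "real j * x"] by simp
  have "x / 2 * (\<Sum>j\<in>{R<..N}. real j * f j) \<le> (\<Sum>j\<in>{R<..N}. ?w j)"
    unfolding sum_distrib_left
  proof (rule sum_mono)
    fix j assume j: "j \<in> {R<..N}"
    then have "real j * x \<ge> 2" using R by (simp add: x_def field_simps)
    from mult_right_mono[OF convex_weight_ge[OF this] f[of j]] j
    show "x / 2 * (real j * f j) \<le> ?w j" unfolding e by (simp add: mult_ac)
  qed
  also have "\<dots> \<le> convex_moment N f x"
    using split[of ?w] sum_nonneg[of "{1..R}" ?w] nn by (simp add: convex_moment_def)
  also have "\<dots> \<le> A * x powr (5/4)" by (rule bar[OF x])
  also have "x powr (5/4) = x * x powr (1/4)"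
    using x powr_add[of x 1 "1/4"] by simp
  finally have "x * (\<Sum>j\<in>{R<..N}. real j * f j) \<le> x * (2 * A * x powr (1/4))" by (simp add: mult_ac)
  then have "(\<Sum>j\<in>{R<..N}. real j * f j) \<le> 2 * A * x powr (1/4)" using x by simp
  then show ?thesis using split[of "\<lambda>j. real j * f j"] by (simp add: x_def tail_bound_def)
qed

section \<open>The Euler scheme for the given initial data\<close>

locale cf_data =
  fixes \<rho>0 :: "nat \<Rightarrow> real"
  assumes init_nonneg: "\<And>j. j \<ge> 1 \<Longrightarrow> \<rho>0 j \<ge> 0"
    and init_mass: "(\<lambda>j. real j * \<rho>0 j) summable_on {1..}" "(\<Sum>\<^sub>\<infinity>j\<in>{1..}. real j * \<rho>0 j) \<le> 1/2"
    and init_second_moment: "(\<lambda>j. (real j)\<^sup>2 * \<rho>0 j) summable_on {1..}"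
begin

definition dt :: "nat \<Rightarrow> real" where "dt N = 1 / (12 * (real N)\<^sup>2)"

definition scheme :: "nat \<Rightarrow> nat \<Rightarrow> nat \<Rightarrow> real" where
  "scheme N n = (euler_step N (dt N) ^^ n) (\<lambda>i. if i \<in> {1..N} then \<rho>0 i else 0)"

text \<open>The 8 lets the barrier absorb the source term of a step, and the second moment makes it
  hold initially.\<close>

definition barrier :: real where "barrier = 8 + (\<Sum>\<^sub>\<infinity>j\<in>{1..}. (real j)\<^sup>2 * \<rho>0 j)"

lemma barrier_ge: "barrier \<ge> 8"
  unfolding barrier_def using infsum_nonneg[of "{1..}" "\<lambda>j. (real j)\<^sup>2 * \<rho>0 j"] init_nonneg by auto

lemma scheme_0: "scheme N 0 i = (if i \<in> {1..N} then \<rho>0 i else 0)"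
  by (simp add: scheme_def)

lemma scheme_Suc: "scheme N (Suc n) = euler_step N (dt N) (scheme N n)"
  by (simp add: scheme_def)

lemma scheme_mass: "mass_upto N (scheme N n) = mass_upto N \<rho>0"
  by (induction n) (simp_all add: scheme_0 scheme_Suc sum_mass_euler_step[unfolded One_nat_def])

lemma init_mass_upto: "mass_upto N \<rho>0 \<le> 1/2"
proof -
  have "mass_upto N \<rho>0 \<le> (\<Sum>\<^sub>\<infinity>j\<in>{1..}. real j * \<rho>0 j)"
    by (rule finite_sum_le_infsum[OF init_mass(1)]) (use init_nonneg in auto)
  with init_mass(2) show ?thesis by simp
qed

lemma scheme_mass_le: "mass_upto N (scheme N n) \<le> 1/2"
  unfolding scheme_mass by (rule init_mass_upto)

lemma dt_pos: "N \<ge> 1 \<Longrightarrow> dt N > 0" and dt_le: "N \<ge> 1 \<Longrightarrow> dt N * real N \<le> 1"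
  by (simp_all add: dt_def power2_eq_square field_simps)

lemma scheme_nonneg:
  assumes "N \<ge> 1" shows "scheme N n i \<ge> 0"
proof (induction n arbitrary: i)
  case (Suc n)
  show ?case unfolding scheme_Suc
    by (rule euler_step_nonneg) (use Suc scheme_mass_le dt_le[OF assms] dt_pos[OF assms] in auto)
qed (use init_nonneg in \<open>auto simp: scheme_0\<close>)

text \<open>The step lemma propagates the barrier with an unchanged constant, so the bound depends
  on neither \<open>n\<close> nor \<open>N\<close>. Initially it comes from the mass for
  \<open>x >= 1\<close> and from the second moment for smaller \<open>x\<close>.\<close>

lemma scheme_barrier:
  assumes N: "N \<ge> 1" and x: "x > 0"
  shows "convex_moment N (scheme N n) x \<le> barrier * x powr (5/4)"
  using x
proof (induction n arbitrary: x)
  case 0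
  have f: "scheme N 0 i \<ge> 0" for i by (rule scheme_nonneg[OF N])
  show ?case
  proof (cases "x \<ge> 1")
    case True
    have "convex_moment N (scheme N 0) x \<le> x * mass_upto N (scheme N 0)"
      by (rule convex_moment_le) (use f 0 in auto)
    also have "\<dots> \<le> x * (1/2)" by (rule mult_left_mono[OF scheme_mass_le]) (use 0 in auto)
    also have "\<dots> \<le> barrier * x" using 0 barrier_ge by (simp add: mult.commute)
    also have "\<dots> \<le> barrier * x powr (5/4)"
      using powr_mono[of 1 "5/4" x] True barrier_ge by auto
    finally show ?thesis .
  next
    case False
    have "(\<Sum>j=1..N. (real j)\<^sup>2 * scheme N 0 j) = (\<Sum>j=1..N. (real j)\<^sup>2 * \<rho>0 j)"
      by (simp add: scheme_0)
    also have "\<dots> \<le> (\<Sum>\<^sub>\<infinity>j\<in>{1..}. (real j)\<^sup>2 * \<rho>0 j)"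
      by (rule finite_sum_le_infsum[OF init_second_moment]) (use init_nonneg in auto)
    also have "\<dots> \<le> barrier" by (simp add: barrier_def)
    finally have m2: "(\<Sum>j=1..N. (real j)\<^sup>2 * scheme N 0 j) \<le> barrier" .
    have "convex_moment N (scheme N 0) x \<le> x\<^sup>2 / 2 * (\<Sum>j=1..N. (real j)\<^sup>2 * scheme N 0 j)"
      by (rule convex_moment_le) (use f 0 in auto)
    also have "\<dots> \<le> x\<^sup>2 / 2 * barrier" by (rule mult_left_mono[OF m2]) auto
    also have "\<dots> \<le> x\<^sup>2 * barrier" using barrier_ge by simp
    also have "x\<^sup>2 = x powr 2" using 0 by simp
    also have "x powr 2 * barrier \<le> x powr (5/4) * barrier"
      using 0 False barrier_ge by (intro mult_right_mono powr_mono') auto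
    finally show ?thesis by (simp add: mult.commute)
  qed
next
  case (Suc n)
  show ?case unfolding scheme_Suc
    by (rule convex_moment_euler_step)
      (use Suc N scheme_nonneg[OF N] scheme_mass_le barrier_ge in \<open>auto simp: dt_def\<close>)
qed

lemma scheme_tail:
  assumes "1 \<le> R" "R \<le> N"
  shows "mass_upto N (scheme N n) - mass_upto R (scheme N n) \<le> tail_bound barrier R"
proof -
  have N: "N \<ge> 1" using assms by simp
  show ?thesis
    by (rule mass_tail_le)
      (use assms scheme_nonneg[OF N] scheme_barrier[OF N] barrier_ge in auto)
qed

lemma scheme_le_1: "N \<ge> 1 \<Longrightarrow> i \<in> {1..N} \<Longrightarrow> \<bar>scheme N n i\<bar> \<le> 1"
proof -
  assume N: "N \<ge> 1" and i: "i \<in> {1..N}"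
  have "1 * scheme N n i \<le> real i * scheme N n i"
    using i scheme_nonneg[OF N] by (intro mult_right_mono) auto
  also have "\<dots> \<le> mass_upto N (scheme N n)"
    by (rule member_le_sum[OF i]) (use scheme_nonneg[OF N] in auto)
  finally show ?thesis using scheme_mass_le[of N n] scheme_nonneg[OF N, of n i] by simp
qed

lemma scheme_bounded: "N \<ge> 1 \<Longrightarrow> \<bar>scheme N n i\<bar> \<le> 1"
proof (cases "i \<in> {1..N}")
  case False
  then have "scheme N n i = 0" by (cases n) (auto simp: scheme_0 scheme_Suc euler_step_def)
  then show ?thesis by simp
qed (rule scheme_le_1)

lemma trunc_kernel_le: "\<bar>trunc_kernel N j k\<bar> \<le> real j * real k"
  by (simp add: trunc_kernel_def)

lemma scheme_diff_Suc:
  assumes N: "N \<ge> 1"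
  shows "\<bar>scheme N (Suc n) i - scheme N n i\<bar> \<le> 2 * dt N"
proof (cases "i \<in> {1..N}")
  case True
  have "\<bar>weak_rhs (trunc_kernel N) N (\<lambda>j. of_bool (j = i)) (scheme N n)\<bar> \<le> 2 * 1"
    by (rule weak_rhs_bound) (use scheme_nonneg[OF N] scheme_mass_le trunc_kernel_le in auto)
  then have "dt N * \<bar>weak_rhs (trunc_kernel N) N (\<lambda>j. of_bool (j = i)) (scheme N n)\<bar> \<le> dt N * (2 * 1)"
    using dt_pos[OF N] by (intro mult_left_mono) auto
  then show ?thesis using True dt_pos[OF N] by (simp add: scheme_Suc euler_step_def abs_mult)
next
  case False
  then have "scheme N n i = 0" for n by (cases n) (auto simp: scheme_0 scheme_Suc euler_step_def)
  then show ?thesis using dt_pos[OF N] by simp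
qed

lemma scheme_diff:
  assumes N: "N \<ge> 1"
  shows "\<bar>scheme N n i - scheme N p i\<bar> \<le> 2 * dt N * \<bar>real n - real p\<bar>"
proof -
  have le: "\<bar>scheme N (p + k) i - scheme N p i\<bar> \<le> 2 * dt N * real k" for p k
  proof (induction k)
    case (Suc k)
    then show ?case using scheme_diff_Suc[OF N, of "p + k" i] by (simp add: algebra_simps)
  qed simp
  show ?thesis
    using le[of p "n - p"] le[of n "p - n"]
    by (cases "p \<le> n") (auto simp: of_nat_diff abs_minus_commute)
qed

text \<open>Equicontinuity of the right-hand side in time, uniform in \<open>N\<close>: passing to
  heads costs two tails, and the heads are Lipschitz in components that move at speed at most
  2.\<close>

lemma scheme_rhs_diff:
  assumes g: "\<And>i. i \<ge> 1 \<Longrightarrow> \<bar>g i\<bar> \<le> B" and R: "1 \<le> R" "2 * R \<le> N"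
  shows "\<bar>weak_rhs (trunc_kernel N) N g (scheme N n) - weak_rhs (trunc_kernel N) N g (scheme N p)\<bar>
    \<le> 6 * B * tail_bound barrier R + 12 * B * real R ^ 4 * (dt N * \<bar>real n - real p\<bar>)"
proof -
  have N: "N \<ge> 1" using R by simp
  have B: "B \<ge> 0" using g[of 1] by auto
  let ?W = "\<lambda>K n. weak_rhs (trunc_kernel N) K g (scheme N n)"
  have 1: "\<bar>?W N n - ?W R n\<bar> \<le> 3 * B * tail_bound barrier R" for n
  proof -
    have "\<bar>?W N n - ?W R n\<bar> \<le> 3 * B * (mass_upto N (scheme N n) - mass_upto R (scheme N n))"
      by (rule weak_rhs_head_approx) (use g scheme_nonneg[OF N] scheme_mass_le trunc_kernel_le R in auto)
    also have "\<dots> \<le> 3 * B * tail_bound barrier R"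
      by (intro mult_left_mono scheme_tail) (use B R in auto)
    finally show ?thesis .
  qed
  have "\<bar>?W R n - ?W R p\<bar> \<le> 6 * B * real R ^ 4 * (2 * dt N * \<bar>real n - real p\<bar>)"
    by (rule weak_rhs_Lipschitz) (use g scheme_bounded[OF N] trunc_kernel_le scheme_diff[OF N] in auto)
  with 1[of n] 1[of p] show ?thesis by linarith
qed

text \<open>The increments telescope, and each right-hand side is compared with the one at index
  \<open>r\<close>. Leaving \<open>r\<close> free between \<open>p\<close> and \<open>q\<close>
  later allows difference quotients on either side of a given time.\<close>

lemma scheme_increment:
  assumes g: "\<And>i. i \<ge> 1 \<Longrightarrow> \<bar>g i\<bar> \<le> B" and R: "1 \<le> R" "2 * R \<le> N" and "p \<le> r" "r \<le> q"
  defines "h \<equiv> dt N * (real q - real p)"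
  shows "\<bar>(\<Sum>j=1..N. g j * scheme N q j) - (\<Sum>j=1..N. g j * scheme N p j)
      - h * weak_rhs (trunc_kernel N) N g (scheme N r)\<bar>
    \<le> h * (6 * B * tail_bound barrier R + 12 * B * real R ^ 4 * h)"
proof -
  have N: "N \<ge> 1" using R by simp
  have B: "B \<ge> 0" using g[of 1] by auto
  have d0: "dt N > 0" by (rule dt_pos[OF N])
  let ?W = "\<lambda>n. weak_rhs (trunc_kernel N) N g (scheme N n)"
  let ?S = "\<lambda>n. \<Sum>j=1..N. g j * scheme N n j"
  let ?E = "6 * B * tail_bound barrier R + 12 * B * real R ^ 4 * h"
  have pq: "p \<le> q" using assms by simp
  have step: "?S (Suc n) - ?S n = dt N * ?W n" for n
    unfolding scheme_Suc using sum_euler_step[of g] by simp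
  have "?S q - ?S p = (\<Sum>n=p..<q. ?S (Suc n) - ?S n)"
    using sum_Suc_diff'[OF pq, of ?S] by (rule sym)
  also have "\<dots> = (\<Sum>n=p..<q. dt N * ?W n)" by (simp only: step)
  finally have eq: "?S q - ?S p - h * ?W r = (\<Sum>n=p..<q. dt N * (?W n - ?W r))"
    using pq by (simp add: h_def right_diff_distrib sum_subtractf of_nat_diff algebra_simps)
  have "\<bar>\<Sum>n=p..<q. dt N * (?W n - ?W r)\<bar> \<le> (\<Sum>n=p..<q. dt N * ?E)"
  proof (rule order.trans[OF sum_abs sum_mono])
    fix n assume n: "n \<in> {p..<q}"
    have "dt N * \<bar>real n - real r\<bar> \<le> h"
      unfolding h_def using d0 n assms(4,5) by (intro mult_left_mono) auto
    then have "12 * B * real R ^ 4 * (dt N * \<bar>real n - real r\<bar>) \<le> 12 * B * real R ^ 4 * h"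
      using B by (intro mult_left_mono) auto
    with scheme_rhs_diff[where g = g and B = B and n = n and p = r, OF g R] have "\<bar>?W n - ?W r\<bar> \<le> ?E" by simp
    then show "\<bar>dt N * (?W n - ?W r)\<bar> \<le> dt N * ?E"
      using d0 by (simp add: abs_mult)
  qed
  moreover have "(\<Sum>n=p..<q. dt N * ?E) = h * ?E" using pq by (simp add: h_def of_nat_diff)
  ultimately show ?thesis unfolding eq by (rule ord_le_eq_trans)
qed

end

section \<open>Passage to the limit\<close>

text \<open>An exchange of limits: \<open>R\<close> is fixed first so that both truncation errors
  are small, and then convergence of the single head \<open>h R\<close> is used.\<close>

lemma tendsto_by_heads:
  fixes X :: "nat \<Rightarrow> real"
  assumes approx: "\<And>R. R \<ge> 1 \<Longrightarrow> \<forall>\<^sub>F n in sequentially. \<bar>X n - h R n\<bar> \<le> e R"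
    and heads: "\<And>R. R \<ge> 1 \<Longrightarrow> h R \<longlonglongrightarrow> l R"
    and lim: "\<And>R. R \<ge> 1 \<Longrightarrow> \<bar>L - l R\<bar> \<le> e R"
    and e: "(e :: nat \<Rightarrow> real) \<longlonglongrightarrow> 0"
  shows "X \<longlonglongrightarrow> L"
proof (rule tendstoI)
  fix \<epsilon> :: real assume eps: "\<epsilon> > 0"
  have "\<forall>\<^sub>F R in sequentially. e R < \<epsilon> / 3"
    by (rule order_tendstoD(2)[OF e]) (use eps in simp)
  then have "\<forall>\<^sub>F R in sequentially. R \<ge> 1 \<and> e R < \<epsilon> / 3"
    using eventually_ge_at_top[of 1] by eventually_elim auto
  then obtain R where R: "R \<ge> 1" "e R < \<epsilon> / 3"
    using eventually_happens'[OF sequentially_bot] by blast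
  have "\<forall>\<^sub>F n in sequentially. dist (h R n) (l R) < \<epsilon> / 3"
    by (rule tendstoD[OF heads[OF R(1)]]) (use eps in simp)
  then show "\<forall>\<^sub>F n in sequentially. dist (X n) L < \<epsilon>"
    using approx[OF R(1)]
  proof eventually_elim
    case (elim n)
    then show ?case using lim[OF R(1)] R(2) unfolding dist_real_def by linarith
  qed
qed

lemma has_sum_product_nonneg:
  fixes u :: "'x \<Rightarrow> real" and v :: "'y \<Rightarrow> real"
  assumes u: "u summable_on A" "\<And>x. x \<in> A \<Longrightarrow> u x \<ge> 0" and v: "v summable_on B" "\<And>y. y \<in> B \<Longrightarrow> v y \<ge> 0"
  shows "((\<lambda>(x, y). u x * v y) has_sum (infsum u A * infsum v B)) (A \<times> B)"
proof (rule has_sum_SigmaI)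
  show rows: "((\<lambda>y. case (x, y) of (x, y) \<Rightarrow> u x * v y) has_sum (u x * infsum v B)) B" for x
    using has_sum_cmult_right[OF has_sum_infsum[OF v(1)]] by simp
  show "((\<lambda>x. u x * infsum v B) has_sum (infsum u A * infsum v B)) A"
    by (rule has_sum_cmult_left[OF has_sum_infsum[OF u(1)]])
  show "(\<lambda>(x, y). u x * v y) summable_on A \<times> B"
    by (rule summable_on_SigmaI[OF rows summable_on_cmult_left[OF u(1)]]) (use u v in auto)
qed

text \<open>The coagulation part is an iterated sum, as in \<open>cf_solution\<close>. The estimates
  are made over pairs, and summability over pairs identifies the two.\<close>

definition weak_rhs_inf :: "(nat \<Rightarrow> real) \<Rightarrow> (nat \<Rightarrow> real) \<Rightarrow> real" where
  "weak_rhs_inf g f = (1/2) * (\<Sum>\<^sub>\<infinity>j\<in>{1..}. \<Sum>\<^sub>\<infinity>k\<in>{1..}. coag_term mult_kernel g f j k)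
     - (1/2) * (\<Sum>\<^sub>\<infinity>j\<in>{1..}. frag_term (\<lambda>j k. 1) g f j)"

lemma mult_kernel_le: "\<bar>mult_kernel j k\<bar> \<le> real j * real k"
  by (simp add: mult_kernel_def)

lemma weak_rhs_inf_head_approx:
  assumes g: "\<And>i. i \<ge> 1 \<Longrightarrow> \<bar>g i\<bar> \<le> B" and f: "\<And>i. i \<ge> 1 \<Longrightarrow> f i \<ge> 0"
    and M: "(\<lambda>j. real j * f j) summable_on {1..}"
  shows "(\<lambda>(j, k). coag_term mult_kernel g f j k) summable_on {1..} \<times> {1..}"
    and "frag_term (\<lambda>j k. 1) g f summable_on {1..}"
    and "(\<Sum>\<^sub>\<infinity>j\<in>{1..}. real j * f j) \<le> 1/2 \<Longrightarrow>
      \<bar>weak_rhs_inf g f - weak_rhs mult_kernel R g f\<bar> \<le> 3 * B * ((\<Sum>\<^sub>\<infinity>j\<in>{1..}. real j * f j) - mass_upto R f)"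
proof -
  have B: "B \<ge> 0" using g[of 1] by auto
  let ?M = "\<Sum>\<^sub>\<infinity>j\<in>{1..}. real j * f j"
  let ?w = "\<lambda>(j, k). (real j * f j) * (real k * f k)"
  have w: "(?w has_sum (?M * ?M)) ({1..} \<times> {1..})"
    by (rule has_sum_product_nonneg) (use M f in auto)
  have c: "\<bar>(\<lambda>(j, k). coag_term mult_kernel g f j k) p\<bar> \<le> 3 * B * ?w p" if "p \<in> {1..} \<times> {1..}" for p
    using that by (auto intro!: coag_term_bound g f mult_kernel_le)
  have fr: "\<bar>frag_term (\<lambda>j k. 1) g f j\<bar> \<le> 3 * B * (real j * f j)" if "j \<in> {1..}" for j
    using that by (auto intro!: frag_term_bound g f)
  have sub: "{1..R} \<times> {1..R} \<subseteq> {1..} \<times> {1..}" for R :: nat by auto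
  show s: "(\<lambda>(j, k). coag_term mult_kernel g f j k) summable_on {1..} \<times> {1..}"
    by (rule infsum_subset_approx(1)[OF has_sum_imp_summable[OF w] c sub]) 
  show "frag_term (\<lambda>j k. 1) g f summable_on {1..}"
    by (rule infsum_subset_approx(1)[OF M fr, of "{}"]) auto
  assume M1: "?M \<le> 1/2"
  have le: "mass_upto R f \<le> ?M"
    by (rule finite_sum_le_infsum[OF M]) (use f in auto)
  have M0: "mass_upto R f \<ge> 0" by (intro sum_nonneg) (use f in auto)
  have it: "(\<Sum>\<^sub>\<infinity>j\<in>{1..}. \<Sum>\<^sub>\<infinity>k\<in>{1..}. coag_term mult_kernel g f j k)
     = infsum (\<lambda>(j, k). coag_term mult_kernel g f j k) ({1..} \<times> {1..})"
    using infsum_Sigma_banach[OF s] by simp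
  have "\<bar>infsum (\<lambda>(j, k). coag_term mult_kernel g f j k) ({1..} \<times> {1..})
       - (\<Sum>(j, k)\<in>{1..R} \<times> {1..R}. coag_term mult_kernel g f j k)\<bar>
     \<le> 3 * B * (?M * ?M - (\<Sum>p\<in>{1..R} \<times> {1..R}. ?w p))"
    using infsum_subset_approx(2)[OF has_sum_imp_summable[OF w] c sub[of R]] infsumI[OF w] by simp
  also have "\<dots> \<le> 3 * B * (?M - mass_upto R f)"
    unfolding sum_square_factor by (intro mult_left_mono square_diff_le) (use M0 le M1 B in auto)
  finally have 1: "\<bar>infsum (\<lambda>(j, k). coag_term mult_kernel g f j k) ({1..} \<times> {1..})
       - (\<Sum>(j, k)\<in>{1..R} \<times> {1..R}. coag_term mult_kernel g f j k)\<bar> \<le> 3 * B * (?M - mass_upto R f)" .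
  have 2: "\<bar>(\<Sum>\<^sub>\<infinity>j\<in>{1..}. frag_term (\<lambda>j k. 1) g f j) - (\<Sum>j=1..R. frag_term (\<lambda>j k. 1) g f j)\<bar>
     \<le> 3 * B * (?M - mass_upto R f)"
    using infsum_subset_approx(2)[OF M fr, of "{1..R}"] by simp
  show "\<bar>weak_rhs_inf g f - weak_rhs mult_kernel R g f\<bar> \<le> 3 * B * (?M - mass_upto R f)"
    unfolding weak_rhs_inf_def weak_rhs_def it using 1 2 by linarith
qed

section \<open>Step functions in time and a convergent subsequence\<close>

context cf_data
begin

text \<open>The index of the last Euler time not after \<open>t\<close>, so that
  \<open>scheme N (step_at N t)\<close> is a step function of \<open>t\<close>.\<close>

definition step_at :: "nat \<Rightarrow> real \<Rightarrow> nat" where "step_at N t = nat \<lfloor>t / dt N\<rfloor>"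

lemma step_at_bounds:
  assumes "N \<ge> 1" "t \<ge> 0"
  shows "dt N * real (step_at N t) \<le> t" "t \<le> dt N * real (step_at N t) + dt N"
proof -
  have d: "dt N > 0" by (rule dt_pos[OF assms(1)])
  have "real (step_at N t) = real_of_int \<lfloor>t / dt N\<rfloor>" using assms d by (simp add: step_at_def)
  then have "real (step_at N t) \<le> t / dt N" "t / dt N \<le> real (step_at N t) + 1"
    using floor_correct[of "t / dt N"] by linarith+
  then show "dt N * real (step_at N t) \<le> t" "t \<le> dt N * real (step_at N t) + dt N"
    using d by (simp_all add: field_simps)
qed

lemma step_at_mono: "N \<ge> 1 \<Longrightarrow> s \<le> t \<Longrightarrow> step_at N s \<le> step_at N t"
  unfolding step_at_def using dt_pos[of N] by (intro nat_mono floor_mono divide_right_mono) auto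

lemma dt_tendsto: "dt \<longlonglongrightarrow> 0"
proof -
  have "filterlim (\<lambda>N. 12 * (real N)\<^sup>2) at_top sequentially"
    by (intro filterlim_tendsto_pos_mult_at_top[OF tendsto_const] filterlim_pow_at_top filterlim_real_sequentially) auto
  then show ?thesis unfolding dt_def[abs_def]
    by (rule real_tendsto_divide_at_top[OF tendsto_const])
qed

lemma step_at_tendsto:
  assumes "t \<ge> 0"
  shows "(\<lambda>N. dt N * real (step_at N t)) \<longlonglongrightarrow> t"
proof (rule real_tendsto_sandwich)
  show "(\<lambda>N. t - dt N) \<longlonglongrightarrow> t" using tendsto_diff[OF tendsto_const dt_tendsto, of t] by simp
  show "\<forall>\<^sub>F N in sequentially. t - dt N \<le> dt N * real (step_at N t)"
    using eventually_ge_at_top[of 1]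
  proof eventually_elim
    case (elim N)
    then show ?case using step_at_bounds(2)[OF elim assms] by linarith
  qed
  show "\<forall>\<^sub>F N in sequentially. dt N * real (step_at N t) \<le> t"
    using eventually_ge_at_top[of 1] by eventually_elim (rule step_at_bounds(1)[OF _ assms])
qed (rule tendsto_const)

lemma scheme_time_diff:
  assumes "N \<ge> 1" "t \<ge> 0" "s \<ge> 0"
  shows "\<bar>scheme N (step_at N t) i - scheme N (step_at N s) i\<bar> \<le> 2 * (\<bar>t - s\<bar> + dt N)"
proof -
  have "dt N * \<bar>real (step_at N t) - real (step_at N s)\<bar>
     = \<bar>dt N * real (step_at N t) - dt N * real (step_at N s)\<bar>"
    using dt_pos[OF assms(1)] by (simp add: abs_mult flip: right_diff_distrib)
  also have "\<dots> \<le> \<bar>t - s\<bar> + dt N"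
    using step_at_bounds[OF assms(1,2)] step_at_bounds[OF assms(1,3)] by linarith
  finally show ?thesis using scheme_diff[OF assms(1), of "step_at N t" i "step_at N s"] by simp
qed

text \<open>The approximations jump in time, so Arzela-Ascoli is carried out by hand: a diagonal
  subsequence converges at all rational times, and the bound of \<open>scheme_time_diff\<close>,
  Lipschitz up to one time step, extends this to every \<open>t\<close>.\<close>

lemma scheme_subsequence:
  obtains K :: "nat \<Rightarrow> nat" and r where "\<And>n. K n \<ge> Suc n"
    "\<And>t j. t \<ge> 0 \<Longrightarrow> (\<lambda>n. scheme (K n) (step_at (K n) t) j) \<longlonglongrightarrow> r j t"
proof -
  define u where "u N t j = scheme N (step_at N t) j" for N t j
  let ?S = "UNIV \<times> \<rat> :: (nat \<times> real) set"
  \<comment> \<open>The shift to \<open>Suc n\<close> keeps the truncation size positive.\<close>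
  have bnd: "norm ((\<lambda>n (j, q). u (Suc n) q j) n p) \<le> 1" for n p
    by (simp add: case_prod_beta u_def scheme_bounded)
  have cS: "countable ?S" by (intro countable_SIGMA countable_rat) auto
  obtain k where k: "strict_mono (k :: nat \<Rightarrow> nat)"
    and lim: "\<And>p. p \<in> ?S \<Longrightarrow> \<exists>l. (\<lambda>n. (\<lambda>n (j, q). u (Suc n) q j) (k n) p) \<longlonglongrightarrow> l"
    by (rule function_convergent_subsequence[where f = "\<lambda>n (j, q). u (Suc n) q j" and M = 1, OF cS bnd]) (rule that)
  define K where "K n = Suc (k n)" for n
  have K: "K n \<ge> Suc n" for n using seq_suble[OF k, of n] by (simp add: K_def)
  have K1: "K n \<ge> 1" for n using K[of n] by simp
  have dtK: "(\<lambda>n. dt (K n)) \<longlonglongrightarrow> 0"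
    by (rule filterlim_compose[OF dt_tendsto]) 
      (rule filterlim_at_top_mono[OF filterlim_Suc], use K in auto)
  have "convergent (\<lambda>n. u (K n) t j)" if t: "t \<ge> 0" for t j
  proof (rule Cauchy_convergent, rule metric_CauchyI)
    fix \<epsilon> :: real assume eps: "\<epsilon> > 0"
    \<comment> \<open>Choosing \<open>q\<close> to the right of \<open>t\<close> keeps it
      nonnegative. A time gap and a step below 1/16 of the tolerance give \<open>near\<close> a
      quarter of it, which leaves room for three comparisons.\<close>
    obtain q where q: "q \<in> \<rat>" "t < q" "q < t + \<epsilon> / 16"
      using Rats_dense_in_real[of t "t + \<epsilon> / 16"] eps by auto
    have "Cauchy (\<lambda>n. u (K n) q j)"
      using lim[of "(j, q)"] q(1) by (auto simp: K_def intro: LIMSEQ_imp_Cauchy)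
    then obtain M1 where M1: "\<And>a b. a \<ge> M1 \<Longrightarrow> b \<ge> M1 \<Longrightarrow> dist (u (K a) q j) (u (K b) q j) < \<epsilon> / 4"
      using eps metric_CauchyD[of "\<lambda>n. u (K n) q j" "\<epsilon> / 4"] by auto
    obtain M2 where M2: "\<And>a. a \<ge> M2 \<Longrightarrow> dt (K a) < \<epsilon> / 16"
      using order_tendstoD(2)[OF dtK, of "\<epsilon> / 16"] eps by (auto simp: eventually_sequentially)
    have near: "\<bar>u (K a) t j - u (K a) q j\<bar> \<le> \<epsilon> / 4" if "a \<ge> M2" for a
      using scheme_time_diff[OF K1 t, of q a j] M2[OF that] q t by (auto simp: u_def)
    show "\<exists>M. \<forall>a\<ge>M. \<forall>b\<ge>M. dist (u (K a) t j) (u (K b) t j) < \<epsilon>"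
    proof (intro exI[of _ "max M1 M2"] allI impI)
      fix a b assume "max M1 M2 \<le> a" "max M1 M2 \<le> b"
      then show "dist (u (K a) t j) (u (K b) t j) < \<epsilon>"
        using M1[of a b] near[of a] near[of b] eps unfolding dist_real_def by (simp add: abs_if split: if_splits)
    qed
  qed
  then have "(\<lambda>n. u (K n) t j) \<longlonglongrightarrow> lim (\<lambda>n. u (K n) t j)" if "t \<ge> 0" for t j
    using that by (simp add: convergent_LIMSEQ_iff)
  then show ?thesis using that[of K "\<lambda>j t. lim (\<lambda>n. u (K n) t j)"] K by (simp add: u_def)
qed

end

section \<open>The limit: mass conservation and the weak equation\<close>

locale cf_limit = cf_data +
  fixes K :: "nat \<Rightarrow> nat" and r :: "nat \<Rightarrow> real \<Rightarrow> real"
  assumes K_ge: "\<And>n. K n \<ge> Suc n"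
    and r_lim: "\<And>t j. t \<ge> 0 \<Longrightarrow> (\<lambda>n. scheme (K n) (step_at (K n) t) j) \<longlonglongrightarrow> r j t"
begin

abbreviation u :: "nat \<Rightarrow> real \<Rightarrow> nat \<Rightarrow> real" where
  "u n t \<equiv> scheme (K n) (step_at (K n) t)"

lemma K1: "K n \<ge> 1" using K_ge[of n] by simp

lemma K_filterlim: "filterlim K at_top sequentially"
  by (rule filterlim_at_top_mono[OF filterlim_Suc]) (use K_ge in auto)

lemma eventually_K_ge: "\<forall>\<^sub>F n in sequentially. C \<le> K n"
  using K_filterlim by (simp add: filterlim_at_top)

lemma r_nonneg: "t \<ge> 0 \<Longrightarrow> r j t \<ge> 0"
  by (rule tendsto_lowerbound[OF r_lim]) (auto simp: scheme_nonneg[OF K1])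

lemma r_init: "j \<ge> 1 \<Longrightarrow> r j 0 = \<rho>0 j"
proof (rule LIMSEQ_unique[OF r_lim])
  assume j: "j \<ge> 1"
  have "\<forall>\<^sub>F n in sequentially. \<rho>0 j = u n 0 j"
    using eventually_K_ge[of j] by eventually_elim (use j in \<open>simp add: step_at_def scheme_0\<close>)
  then show "(\<lambda>n. u n 0 j) \<longlonglongrightarrow> \<rho>0 j"
    by (rule Lim_transform_eventually[OF tendsto_const])
qed simp

definition mass :: real where "mass = (\<Sum>\<^sub>\<infinity>j\<in>{1..}. real j * \<rho>0 j)"

lemma u_mass_tendsto: "(\<lambda>n. mass_upto (K n) (u n t)) \<longlonglongrightarrow> mass"
proof -
  have "((\<lambda>F. \<Sum>j\<in>F. real j * \<rho>0 j) \<longlongrightarrow> mass) (finite_subsets_at_top {1..})"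
    unfolding mass_def by (rule infsum_tendsto[OF init_mass(1)])
  moreover have "filterlim (\<lambda>n. {1..n}) (finite_subsets_at_top {1::nat..}) sequentially"
    unfolding filterlim_finite_subsets_at_top
  proof (intro allI impI)
    fix X :: "nat set" assume X: "finite X \<and> X \<subseteq> {1..}"
    show "\<forall>\<^sub>F n in sequentially. finite {1..n} \<and> X \<subseteq> {1..n} \<and> {1..n} \<subseteq> {1..}"
      using eventually_ge_at_top[of "Max X"]
    proof eventually_elim
      case (elim n)
      then show ?case using X by (auto intro: order.trans[OF Max_ge])
    qed
  qed
  ultimately have "(\<lambda>n. mass_upto n \<rho>0) \<longlonglongrightarrow> mass"
    by (rule filterlim_compose)
  from filterlim_compose[OF this K_filterlim] show ?thesis unfolding scheme_mass .
qed

lemma head_tendsto: "t \<ge> 0 \<Longrightarrow> (\<lambda>n. \<Sum>j=1..R. c j * u n t j) \<longlonglongrightarrow> (\<Sum>j=1..R. c j * r j t)"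
  by (intro tendsto_intros r_lim)

lemma mass_upto_r_le: 
  assumes t: "t \<ge> 0"
  shows "mass_upto R (\<lambda>j. r j t) \<le> mass"
proof (rule tendsto_le[OF sequentially_bot u_mass_tendsto head_tendsto[OF t]])
  show "\<forall>\<^sub>F n in sequentially. mass_upto R (u n t) \<le> mass_upto (K n) (u n t)"
    using eventually_K_ge[of R] by eventually_elim (rule mass_upto_mono, auto simp: scheme_nonneg[OF K1])
qed

lemma mass_upto_r_ge:
  assumes t: "t \<ge> 0" and R: "R \<ge> 1"
  shows "mass - mass_upto R (\<lambda>j. r j t) \<le> tail_bound barrier R"
proof (rule tendsto_upperbound[OF tendsto_diff[OF u_mass_tendsto head_tendsto[OF t]]])
  show "\<forall>\<^sub>F n in sequentially. mass_upto (K n) (u n t) - mass_upto R (u n t) \<le> tail_bound barrier R"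
    using eventually_K_ge[of R] by eventually_elim (rule scheme_tail[OF R])
qed simp

text \<open>Finite heads pass to the limit, which bounds the mass from above. Equality needs
  tightness: the uniform tail bound prevents mass from escaping to infinite sizes.\<close>

lemma r_has_mass:
  assumes t: "t \<ge> 0"
  shows "((\<lambda>j. real j * r j t) has_sum mass) {1..}"
proof -
  have fin: "(\<Sum>j\<in>F. real j * r j t) \<le> mass" if "finite F" "F \<subseteq> {1..}" for F
  proof -
    have "F \<subseteq> {1..Max F}" using that by auto
    then have "(\<Sum>j\<in>F. real j * r j t) \<le> mass_upto (Max F) (\<lambda>j. r j t)"
      by (intro sum_mono2) (use r_nonneg[OF t] in auto)
    with mass_upto_r_le[OF t, of "Max F"] show ?thesis by linarith
  qed
  have s: "(\<lambda>j. real j * r j t) summable_on {1..}"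
    by (rule nonneg_bdd_above_summable_on) (use r_nonneg[OF t] fin in \<open>auto intro!: bdd_aboveI\<close>)
  moreover have "infsum (\<lambda>j. real j * r j t) {1..} = mass"
  proof (rule antisym)
    show "infsum (\<lambda>j. real j * r j t) {1..} \<le> mass" by (rule infsum_le_finite_sums[OF s fin])
    have "mass - tail_bound barrier R \<le> infsum (\<lambda>j. real j * r j t) {1..}" if "R \<ge> 1" for R
    proof -
      have "mass_upto R (\<lambda>j. r j t) \<le> infsum (\<lambda>j. real j * r j t) {1..}"
        by (rule finite_sum_le_infsum[OF s]) (use r_nonneg[OF t] in auto)
      with mass_upto_r_ge[OF t that] show ?thesis by linarith
    qed
    then have "\<forall>\<^sub>F R in sequentially. mass - tail_bound barrier R \<le> infsum (\<lambda>j. real j * r j t) {1..}"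
      by (intro eventually_sequentiallyI[of 1])
    moreover have "(\<lambda>R. mass - tail_bound barrier R) \<longlonglongrightarrow> mass - 0"
      by (intro tendsto_intros tail_bound_tendsto)
    ultimately show "mass \<le> infsum (\<lambda>j. real j * r j t) {1..}"
      using tendsto_upperbound by fastforce
  qed
  ultimately show ?thesis by (simp add: has_sum_iff)
qed

lemma mass_le: "mass \<le> 1/2"
  unfolding mass_def by (rule init_mass(2))

context
  fixes g :: "nat \<Rightarrow> real" and B :: real
  assumes g: "\<And>i. i \<ge> 1 \<Longrightarrow> \<bar>g i\<bar> \<le> B"
begin

lemma B0: "B \<ge> 0" using g[of 1] by auto

lemma weighted_bound: "j \<ge> 1 \<Longrightarrow> f j \<ge> 0 \<Longrightarrow> \<bar>g j * f j\<bar> \<le> B * (real j * f j)"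
proof -
  assume j: "j \<ge> 1" and f: "f j \<ge> 0"
  have "\<bar>g j\<bar> * f j \<le> B * f j" using g[OF j] f by (rule mult_right_mono)
  also have "\<dots> \<le> B * (real j * f j)"
    using mult_right_mono[of 1 "real j" "f j"] j f B0 by (intro mult_left_mono) auto
  finally show ?thesis using f by (simp add: abs_mult)
qed

lemma r_weighted:
  assumes t: "t \<ge> 0"
  shows "(\<lambda>j. g j * r j t) summable_on {1..}"
    and "R \<ge> 1 \<Longrightarrow> \<bar>(\<Sum>\<^sub>\<infinity>j\<in>{1..}. g j * r j t) - (\<Sum>j=1..R. g j * r j t)\<bar> \<le> B * tail_bound barrier R"
proof -
  note w = has_sum_imp_summable[OF r_has_mass[OF t]]
  have c: "\<bar>g j * r j t\<bar> \<le> B * (real j * r j t)" if "j \<in> {1..}" for j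
    using weighted_bound[of j "\<lambda>j. r j t"] r_nonneg[OF t] that by auto
  show "(\<lambda>j. g j * r j t) summable_on {1..}"
    by (rule infsum_subset_approx(1)[OF w c, of "{}"]) auto
  assume R: "R \<ge> 1"
  have "\<bar>(\<Sum>\<^sub>\<infinity>j\<in>{1..}. g j * r j t) - (\<Sum>j=1..R. g j * r j t)\<bar> \<le> B * (mass - mass_upto R (\<lambda>j. r j t))"
    using infsum_subset_approx(2)[OF w c, of "{1..R}"] infsumI[OF r_has_mass[OF t]] by auto
  also have "\<dots> \<le> B * tail_bound barrier R"
    by (rule mult_left_mono[OF mass_upto_r_ge[OF t R] B0])
  finally show "\<bar>(\<Sum>\<^sub>\<infinity>j\<in>{1..}. g j * r j t) - (\<Sum>j=1..R. g j * r j t)\<bar> \<le> B * tail_bound barrier R" .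
qed

lemma weighted_tendsto:
  assumes t: "t \<ge> 0"
  shows "(\<lambda>n. \<Sum>j=1..K n. g j * u n t j) \<longlonglongrightarrow> (\<Sum>\<^sub>\<infinity>j\<in>{1..}. g j * r j t)"
proof (rule tendsto_by_heads[where h = "\<lambda>R n. \<Sum>j=1..R. g j * u n t j" and l = "\<lambda>R. \<Sum>j=1..R. g j * r j t"
      and e = "\<lambda>R. B * tail_bound barrier R"])
  fix R :: nat assume R: "R \<ge> 1"
  show "(\<lambda>n. \<Sum>j=1..R. g j * u n t j) \<longlonglongrightarrow> (\<Sum>j=1..R. g j * r j t)" by (rule head_tendsto[OF t])
  show "\<bar>(\<Sum>\<^sub>\<infinity>j\<in>{1..}. g j * r j t) - (\<Sum>j=1..R. g j * r j t)\<bar> \<le> B * tail_bound barrier R"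
    by (rule r_weighted(2)[OF t R])
  show "\<forall>\<^sub>F n in sequentially. \<bar>(\<Sum>j=1..K n. g j * u n t j) - (\<Sum>j=1..R. g j * u n t j)\<bar> \<le> B * tail_bound barrier R"
    using eventually_K_ge[of R]
  proof eventually_elim
    case (elim n)
    have "\<bar>(\<Sum>j=1..K n. g j * u n t j) - (\<Sum>j=1..R. g j * u n t j)\<bar> \<le> B * (mass_upto (K n) (u n t) - mass_upto R (u n t))"
      by (rule sum_subset_approx) (use elim scheme_nonneg[OF K1] in \<open>auto intro!: weighted_bound\<close>)
    also have "\<dots> \<le> B * tail_bound barrier R"
      by (rule mult_left_mono[OF scheme_tail[OF R elim] B0])
    finally show ?case .
  qed
next
  show "(\<lambda>R. B * tail_bound barrier R) \<longlonglongrightarrow> 0"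
    using tendsto_mult_left[OF tail_bound_tendsto, of B] by simp
qed

text \<open>Once \<open>K n\<close> is at least \<open>2 * R\<close>, the head has the untruncated
  kernel and is a fixed polynomial in finitely many components, so it converges; the tails are
  uniformly small.\<close>

lemma rhs_tendsto:
  assumes t: "t \<ge> 0"
  shows "(\<lambda>n. weak_rhs (trunc_kernel (K n)) (K n) g (u n t)) \<longlonglongrightarrow> weak_rhs_inf g (\<lambda>j. r j t)"
proof (rule tendsto_by_heads[where h = "\<lambda>R n. weak_rhs mult_kernel R g (u n t)"
      and l = "\<lambda>R. weak_rhs mult_kernel R g (\<lambda>j. r j t)" and e = "\<lambda>R. 3 * B * tail_bound barrier R"])
  fix R :: nat assume R: "R \<ge> 1"
  show "(\<lambda>n. weak_rhs mult_kernel R g (u n t)) \<longlonglongrightarrow> weak_rhs mult_kernel R g (\<lambda>j. r j t)"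
    unfolding weak_rhs_def coag_term_def frag_term_def case_prod_beta
    by (intro tendsto_intros r_lim t)
  have "\<bar>weak_rhs_inf g (\<lambda>j. r j t) - weak_rhs mult_kernel R g (\<lambda>j. r j t)\<bar>
      \<le> 3 * B * ((\<Sum>\<^sub>\<infinity>j\<in>{1..}. real j * r j t) - mass_upto R (\<lambda>j. r j t))"
    by (rule weak_rhs_inf_head_approx(3))
      (use g r_nonneg[OF t] has_sum_imp_summable[OF r_has_mass[OF t]] infsumI[OF r_has_mass[OF t]] mass_le in auto)
  also have "\<dots> \<le> 3 * B * tail_bound barrier R"
    using mass_upto_r_ge[OF t R] B0 infsumI[OF r_has_mass[OF t]] by (intro mult_left_mono) auto
  finally show "\<bar>weak_rhs_inf g (\<lambda>j. r j t) - weak_rhs mult_kernel R g (\<lambda>j. r j t)\<bar> \<le> 3 * B * tail_bound barrier R" .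
  show "\<forall>\<^sub>F n in sequentially. \<bar>weak_rhs (trunc_kernel (K n)) (K n) g (u n t) - weak_rhs mult_kernel R g (u n t)\<bar>
      \<le> 3 * B * tail_bound barrier R"
    using eventually_K_ge[of "2 * R"]
  proof eventually_elim
    case (elim n)
    then have RK: "R \<le> K n" by simp
    have "\<bar>weak_rhs (trunc_kernel (K n)) (K n) g (u n t) - weak_rhs (trunc_kernel (K n)) R g (u n t)\<bar>
       \<le> 3 * B * (mass_upto (K n) (u n t) - mass_upto R (u n t))"
      by (rule weak_rhs_head_approx) (use g scheme_nonneg[OF K1] scheme_mass_le trunc_kernel_le RK in auto)
    also have "\<dots> \<le> 3 * B * tail_bound barrier R"
      using B0 by (intro mult_left_mono scheme_tail[OF R RK]) auto
    finally show ?case unfolding weak_rhs_trunc_kernel[OF elim] .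
  qed
next
  show "(\<lambda>R. 3 * B * tail_bound barrier R) \<longlonglongrightarrow> 0"
    using tendsto_mult_left[OF tail_bound_tendsto, of "3 * B"] by simp
qed

text \<open>The estimate \<open>scheme_increment\<close> passes to the limit. The right-hand side is
  allowed at either end of the interval, so that both one-sided difference quotients at a time can
  be estimated.\<close>

lemma increment_limit:
  assumes s: "0 \<le> s" "s \<le> t" and q: "q = s \<or> q = t" and R: "R \<ge> 1"
  shows "\<bar>(\<Sum>\<^sub>\<infinity>j\<in>{1..}. g j * r j t) - (\<Sum>\<^sub>\<infinity>j\<in>{1..}. g j * r j s) - (t - s) * weak_rhs_inf g (\<lambda>j. r j q)\<bar>
     \<le> (t - s) * (6 * B * tail_bound barrier R + 12 * B * real R ^ 4 * (t - s))"
proof -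
  have t: "t \<ge> 0" and q0: "q \<ge> 0" using s q by auto
  define h where "h n = dt (K n) * (real (step_at (K n) t) - real (step_at (K n) s))" for n
  have h: "h \<longlonglongrightarrow> t - s"
    unfolding h_def[abs_def] right_diff_distrib
    by (intro tendsto_diff filterlim_compose[OF step_at_tendsto K_filterlim] t s)
  show ?thesis
  proof (rule tendsto_le[OF sequentially_bot])
    show "(\<lambda>n. h n * (6 * B * tail_bound barrier R + 12 * B * real R ^ 4 * h n))
       \<longlonglongrightarrow> (t - s) * (6 * B * tail_bound barrier R + 12 * B * real R ^ 4 * (t - s))"
      by (intro tendsto_intros h)
    show "(\<lambda>n. \<bar>(\<Sum>j=1..K n. g j * u n t j) - (\<Sum>j=1..K n. g j * u n s j)
          - h n * weak_rhs (trunc_kernel (K n)) (K n) g (u n q)\<bar>)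
       \<longlonglongrightarrow> \<bar>(\<Sum>\<^sub>\<infinity>j\<in>{1..}. g j * r j t) - (\<Sum>\<^sub>\<infinity>j\<in>{1..}. g j * r j s) - (t - s) * weak_rhs_inf g (\<lambda>j. r j q)\<bar>"
      by (intro tendsto_rabs tendsto_diff tendsto_mult h weighted_tendsto rhs_tendsto t s q0)
    show "\<forall>\<^sub>F n in sequentially. \<bar>(\<Sum>j=1..K n. g j * u n t j) - (\<Sum>j=1..K n. g j * u n s j)
          - h n * weak_rhs (trunc_kernel (K n)) (K n) g (u n q)\<bar>
       \<le> h n * (6 * B * tail_bound barrier R + 12 * B * real R ^ 4 * h n)"
      using eventually_K_ge[of "2 * R"]
    proof eventually_elim
      case (elim n)
      show ?case unfolding h_def
        by (rule scheme_increment) (use g R elim q s step_at_mono[OF K1] in auto)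
    qed
  qed
qed

text \<open>The order of choices matters: \<open>R\<close> first makes the tail term small, and then
  \<open>s\<close> close to \<open>t\<close> compensates for the power of \<open>R\<close>.\<close>

lemma weighted_has_derivative:
  assumes t: "t \<ge> 0"
  shows "((\<lambda>s. \<Sum>\<^sub>\<infinity>j\<in>{1..}. g j * r j s) has_real_derivative weak_rhs_inf g (\<lambda>j. r j t)) (at t within {0..})"
proof -
  let ?f = "\<lambda>s. \<Sum>\<^sub>\<infinity>j\<in>{1..}. g j * r j s" and ?D = "weak_rhs_inf g (\<lambda>j. r j t)"
  have est: "\<bar>(?f s - ?f t) / (s - t) - ?D\<bar> \<le> 6 * B * tail_bound barrier R + 12 * B * real R ^ 4 * \<bar>s - t\<bar>"
    if s: "s \<ge> 0" "s \<noteq> t" and R: "R \<ge> 1" for s R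
  proof -
    have "\<bar>?f s - ?f t - (s - t) * ?D\<bar>
       \<le> \<bar>s - t\<bar> * (6 * B * tail_bound barrier R + 12 * B * real R ^ 4 * \<bar>s - t\<bar>)"
      using increment_limit[of s t t R] increment_limit[of t s t R] s t R
      by (cases "s \<le> t") (auto simp: abs_if algebra_simps split: if_splits)
    moreover have "?f s - ?f t - (s - t) * ?D = (s - t) * ((?f s - ?f t) / (s - t) - ?D)"
      unfolding right_diff_distrib[of "s - t" "(?f s - ?f t) / (s - t)"] using s by simp
    then have "\<bar>?f s - ?f t - (s - t) * ?D\<bar> = \<bar>s - t\<bar> * \<bar>(?f s - ?f t) / (s - t) - ?D\<bar>"
      by (simp only: abs_mult)
    ultimately show ?thesis using s by simp
  qed
  show ?thesis
    unfolding has_field_derivative_iff Lim_within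
  proof (intro allI impI)
    fix \<epsilon> :: real assume eps: "\<epsilon> > 0"
    have "(\<lambda>R. 6 * B * tail_bound barrier R) \<longlonglongrightarrow> 0"
      using tendsto_mult_left[OF tail_bound_tendsto, of "6 * B"] by simp
    then have "\<forall>\<^sub>F R in sequentially. 6 * B * tail_bound barrier R < \<epsilon> / 2"
      by (rule order_tendstoD(2)) (use eps in simp)
    then have "\<forall>\<^sub>F R in sequentially. R \<ge> 1 \<and> 6 * B * tail_bound barrier R < \<epsilon> / 2"
      using eventually_ge_at_top[of 1] by eventually_elim auto
    then obtain R where R: "R \<ge> 1" "6 * B * tail_bound barrier R < \<epsilon> / 2"
      using eventually_happens'[OF sequentially_bot] by blast
    \<comment> \<open>The added 1 keeps \<open>C\<close> positive when \<open>B = 0\<close>, so that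
      it can be divided by.\<close>
    define C where "C = 12 * B * real R ^ 4 + 1"
    have C: "C > 0" using B0 by (simp add: C_def add_nonneg_pos)
    show "\<exists>d>0. \<forall>s\<in>{0..}. 0 < dist s t \<and> dist s t < d \<longrightarrow> dist ((?f s - ?f t) / (s - t)) ?D < \<epsilon>"
    proof (intro exI[of _ "\<epsilon> / (2 * C)"] conjI ballI impI)
      show "\<epsilon> / (2 * C) > 0" using eps C by simp
      fix s assume s: "s \<in> {0..}" "0 < dist s t \<and> dist s t < \<epsilon> / (2 * C)"
      have "12 * B * real R ^ 4 * \<bar>s - t\<bar> \<le> C * \<bar>s - t\<bar>" by (intro mult_right_mono) (auto simp: C_def)
      also have "\<dots> < \<epsilon> / 2" using s C by (simp add: dist_real_def field_simps)
      finally show "dist ((?f s - ?f t) / (s - t)) ?D < \<epsilon>"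
        using est[of s R] s R by (auto simp: dist_real_def)
    qed
  qed
qed

end

end

section \<open>Uniqueness by a maximum principle\<close>

lemma has_sum_imp_sums_from_1:
  fixes f :: "nat \<Rightarrow> real"
  assumes "(f has_sum S) {1..}"
  shows "(\<lambda>n. if n = 0 then 0 else f n) sums S" "(\<lambda>n. f (Suc n)) sums S"
proof -
  have "((\<lambda>n. if n = 0 then 0 else f n) has_sum S) UNIV"
    using assms by (rule has_sum_cong_neutral[THEN iffD1, rotated 3]) auto
  then show 1: "(\<lambda>n. if n = 0 then 0 else f n) sums S" by (rule has_sum_imp_sums)
  then show "(\<lambda>n. f (Suc n)) sums S"
    using sums_Suc_iff[of "\<lambda>n. if n = 0 then 0 else f n" S] by simp
qed

lemma has_sum_diff:
  fixes f g :: "'x \<Rightarrow> real"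
  assumes "(f has_sum a) A" "(g has_sum b) A"
  shows "((\<lambda>x. f x - g x) has_sum (a - b)) A"
  using has_sum_add[OF assms(1) has_sum_uminusI[OF assms(2)]] by simp

lemma powser_eq_0_imp_const_0:
  fixes c :: "nat \<Rightarrow> real"
  assumes "summable c" "\<And>z. 0 < z \<Longrightarrow> z < 1 \<Longrightarrow> (\<Sum>n. c n * z ^ n) = 0"
  shows "c 0 = 0"
proof -
  have "isCont (\<lambda>z. \<Sum>n. c n * z ^ n) 0"
    by (rule isCont_powser[where K = 1]) (use assms in auto)
  then have "((\<lambda>z. \<Sum>n. c n * z ^ n) \<longlongrightarrow> c 0) (at_right 0)"
    unfolding isCont_def by (auto intro: tendsto_within_subset)
  moreover have "\<forall>\<^sub>F z in at_right 0. (\<Sum>n. c n * z ^ n) = 0"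
    using eventually_at_right_real[OF zero_less_one] by (auto elim!: eventually_mono intro!: assms)
  ultimately have "((\<lambda>_. 0) \<longlongrightarrow> c 0) (at_right (0::real))"
    by (rule Lim_transform_eventually)
  then show ?thesis using tendsto_unique[OF _ _ tendsto_const] trivial_limit_at_right_real by metis
qed

text \<open>The series is known to vanish only on the open interval, so the constant term is found
  by continuity from the right at 0. Dividing by \<open>z\<close> shifts the coefficients and gives
  the induction.\<close>

lemma powser_eq_0_imp_coeff_0:
  fixes c :: "nat \<Rightarrow> real"
  assumes "summable c" "\<And>z. 0 < z \<Longrightarrow> z < 1 \<Longrightarrow> (\<Sum>n. c n * z ^ n) = 0"
  shows "c k = 0"
  using assms
proof (induction k arbitrary: c)
  case 0
  show ?case by (rule powser_eq_0_imp_const_0[OF 0])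
next
  case (Suc k)
  have c0: "c 0 = 0" by (rule powser_eq_0_imp_const_0[OF Suc.prems])
  show ?case
  proof (rule Suc.IH[of "\<lambda>n. c (Suc n)"])
    show "summable (\<lambda>n. c (Suc n))" using Suc.prems(1) by (subst summable_Suc_iff)
    fix z :: real assume z: "0 < z" "z < 1"
    have "summable (\<lambda>n. c n * z ^ n)"
      by (rule powser_inside[where x = 1]) (use Suc.prems z in auto)
    from powser_split_head(1)[OF this] c0 Suc.prems(2)[OF z] z
    show "(\<Sum>n. c (Suc n) * z ^ n) = 0" by simp
  qed
qed

text \<open>Continuity in one variable becomes joint continuity through a Lipschitz bound uniform in
  the other; it provides a maximum on the compact rectangle.\<close>

lemma continuous_on_Times_Lipschitz:
  fixes F :: "real \<Rightarrow> real \<Rightarrow> real"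
  assumes cont: "\<And>z. z \<in> S \<Longrightarrow> continuous_on T (F z)"
    and lip: "\<And>z z' t. z \<in> S \<Longrightarrow> z' \<in> S \<Longrightarrow> t \<in> T \<Longrightarrow> \<bar>F z t - F z' t\<bar> \<le> L * \<bar>z - z'\<bar>"
  shows "continuous_on (S \<times> T) (\<lambda>(z, t). F z t)"
  unfolding continuous_on_def
proof clarify
  fix z t assume z: "z \<in> S" and t: "t \<in> T"
  let ?F = "at (z, t) within S \<times> T"
  have mem: "\<forall>\<^sub>F p in ?F. p \<in> S \<times> T" by (simp add: eventually_at_filter)
  have fs: "(fst \<longlongrightarrow> z) ?F" and sn: "(snd \<longlongrightarrow> t) ?F"
    using tendsto_fst[OF tendsto_ident_at[of "(z, t)" "S \<times> T"]] tendsto_snd[OF tendsto_ident_at[of "(z, t)" "S \<times> T"]]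
    by (simp_all add: comp_def)
  have "((\<lambda>p. F z (snd p)) \<longlongrightarrow> F z t) ?F"
    by (rule continuous_on_tendsto_compose[OF cont[OF z] sn t]) (use mem in \<open>auto elim: eventually_mono\<close>)
  moreover have "((\<lambda>p. F (fst p) (snd p) - F z (snd p)) \<longlongrightarrow> 0) ?F"
  proof (rule Lim_null_comparison)
    show "\<forall>\<^sub>F p in ?F. norm (F (fst p) (snd p) - F z (snd p)) \<le> L * \<bar>fst p - z\<bar>"
      using mem by eventually_elim (use lip z in auto)
    show "((\<lambda>p. L * \<bar>fst p - z\<bar>) \<longlongrightarrow> 0) ?F"
      using tendsto_mult_left[OF tendsto_rabs[OF tendsto_diff[OF fs tendsto_const[of z]]], of L] by simp
  qed
  ultimately have "((\<lambda>p. F z (snd p) + (F (fst p) (snd p) - F z (snd p))) \<longlongrightarrow> F z t + 0) ?F"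
    by (rule tendsto_add)
  then show "((\<lambda>(z, t). F z t) \<longlongrightarrow> F z t) ?F" by (simp add: case_prod_beta')
qed

text \<open>Only points to the left are compared, so the lemma also applies at the final time and on
  the right edge of the rectangle.\<close>

lemma derivative_nonneg_at_left_max:
  fixes f :: "real \<Rightarrow> real"
  assumes "(f has_real_derivative l) (at x within {0..})" "x > 0"
    "\<And>y. 0 \<le> y \<Longrightarrow> y \<le> x \<Longrightarrow> f y \<le> f x"
  shows "l \<ge> 0"
proof (rule ccontr)
  assume "\<not> l \<ge> 0"
  then obtain d where d: "d > 0" "\<And>h. h > 0 \<Longrightarrow> x - h \<in> {0..} \<Longrightarrow> h < d \<Longrightarrow> f x < f (x - h)"
    using has_real_derivative_neg_dec_left[OF assms(1)] by auto
  define h where "h = min (d / 2) x"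
  have "f x < f (x - h)" using d(1) assms(2) by (intro d(2)) (auto simp: h_def)
  moreover have "f (x - h) \<le> f x" using d(1) assms(2) by (intro assms(3)) (auto simp: h_def)
  ultimately show False by simp
qed

section \<open>The generating function of a mass-conserving solution\<close>

locale cf_flow =
  fixes m :: real and r :: "nat \<Rightarrow> real \<Rightarrow> real"
  assumes nonneg: "\<And>j t. j \<ge> 1 \<Longrightarrow> t \<ge> 0 \<Longrightarrow> r j t \<ge> 0"
    and has_mass: "\<And>t. t \<ge> 0 \<Longrightarrow> ((\<lambda>j. real j * r j t) has_sum m) {1..}"
    and has_derivative: "\<And>g t. bounded (g ` {1..}) \<Longrightarrow> t \<ge> 0 \<Longrightarrow>
      ((\<lambda>s. \<Sum>\<^sub>\<infinity>j\<in>{1..}. g j * r j s) has_real_derivative weak_rhs_inf g (\<lambda>j. r j t)) (at t within {0..})"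
begin

definition gen :: "real \<Rightarrow> real \<Rightarrow> real" where
  "gen z t = (\<Sum>\<^sub>\<infinity>j\<in>{1..}. (1 - z ^ j) * r j t)"

text \<open>This is \<open>P = m + z * F\<^sub>z\<close> for \<open>F = gen\<close>, written as a
  single series with nonnegative terms.\<close>

definition slope :: "real \<Rightarrow> real \<Rightarrow> real" where
  "slope z t = (\<Sum>\<^sub>\<infinity>j\<in>{1..}. (real j * (1 - z ^ j)) * r j t)"

lemma weighted_summable:
  assumes t: "t \<ge> 0" and c: "\<And>j. j \<ge> 1 \<Longrightarrow> \<bar>c j\<bar> \<le> C * real j"
  shows "((\<lambda>j. c j * r j t) has_sum (\<Sum>\<^sub>\<infinity>j\<in>{1..}. c j * r j t)) {1..}"
proof -
  have "(\<lambda>j. c j * r j t) summable_on {1..}"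
  proof (rule infsum_subset_approx(1)[OF has_sum_imp_summable[OF has_mass[OF t]], where C = C and F = "{}"])
    fix j :: nat assume j: "j \<in> {1..}"
    have "\<bar>c j\<bar> * r j t \<le> (C * real j) * r j t"
      using c[of j] nonneg[of j t] t j by (intro mult_right_mono) auto
    then show "\<bar>c j * r j t\<bar> \<le> C * (real j * r j t)"
      using nonneg[of j t] t j by (simp add: abs_mult mult.assoc)
  qed simp
  then show ?thesis by simp
qed

lemma gen_has_sum:
  assumes "t \<ge> 0" "0 \<le> z" "z < 1"
  shows "((\<lambda>j. (1 - z ^ j) * r j t) has_sum gen z t) {1..}"
  unfolding gen_def
proof (rule weighted_summable[OF assms(1), where C = 1])
  fix j :: nat assume j: "j \<ge> 1"
  have "0 \<le> z ^ j" "z ^ j \<le> 1" using assms by (auto simp: power_le_one)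
  then show "\<bar>1 - z ^ j\<bar> \<le> 1 * real j" using j by simp
qed

lemma slope_has_sum:
  assumes "t \<ge> 0" "0 \<le> z" "z < 1"
  shows "((\<lambda>j. (real j * (1 - z ^ j)) * r j t) has_sum slope z t) {1..}"
  unfolding slope_def
proof (rule weighted_summable[OF assms(1), where C = 1])
  fix j :: nat assume j: "j \<ge> 1"
  have "0 \<le> z ^ j" "z ^ j \<le> 1" using assms by (auto simp: power_le_one)
  then have "real j * \<bar>1 - z ^ j\<bar> \<le> real j * 1" by (intro mult_left_mono) auto
  then show "\<bar>real j * (1 - z ^ j)\<bar> \<le> 1 * real j" by (simp add: abs_mult)
qed

lemma slope_0: "t \<ge> 0 \<Longrightarrow> slope 0 t = m"
  unfolding slope_def infsumI[OF has_mass, symmetric] by (rule infsum_cong) auto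

lemma slope_nonneg:
  assumes "t \<ge> 0" "0 \<le> z" "z < 1"
  shows "slope z t \<ge> 0"
  unfolding slope_def
proof (rule infsum_nonneg)
  fix j :: nat assume "j \<in> {1..}"
  then show "0 \<le> (real j * (1 - z ^ j)) * r j t"
    using assms nonneg[of j t] by (auto simp: power_le_one)
qed

text \<open>The coagulation defect of \<open>1 - z ^ j\<close> is minus a product, so the kernel
  \<open>j k\<close> makes the double sum minus the square of \<open>slope\<close>. In the
  fragmentation term the summand \<open>2 * j\<close> produces the total mass, and its conservation
  makes this contribution the constant \<open>m\<close>.\<close>

lemma gen_has_derivative:
  assumes t: "t \<ge> 0" and z: "0 \<le> z" "z < 1"
  shows "(gen z has_real_derivative
     (- (slope z t)\<^sup>2 / 2 - slope z t / 2 + m - (1 / (1 - z) - 1/2) * gen z t)) (at t within {0..})"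
proof -
  let ?g = "\<lambda>j::nat. 1 - z ^ j" and ?p = "\<lambda>j. (real j * (1 - z ^ j)) * r j t"
  have "\<bar>1 - z ^ j\<bar> \<le> 1" for j using z by (simp add: power_le_one)
  then have bnd: "bounded (?g ` {1..})" by (auto simp: bounded_iff)
  have coag: "coag_term mult_kernel ?g (\<lambda>j. r j t) j k = - (?p j * ?p k)" for j k
    by (simp add: coag_term_def mult_kernel_def algebra_simps power_add)
  have 1: "(\<Sum>\<^sub>\<infinity>j\<in>{1..}. \<Sum>\<^sub>\<infinity>k\<in>{1..}. coag_term mult_kernel ?g (\<lambda>j. r j t) j k) = - (slope z t)\<^sup>2"
    unfolding coag infsum_uminus infsum_cmult_right' infsum_cmult_left' slope_def power2_eq_square ..
  have frag: "frag_term (\<lambda>j k. 1) ?g (\<lambda>j. r j t) j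
      = - 2 * (real j * r j t) + ?p j + (2 / (1 - z) - 1) * (?g j * r j t)" if "j \<in> {1..}" for j
  proof -
    have "(\<Sum>k\<in>{1..<j}. ?g j - ?g k - ?g (j - k)) = - (\<Sum>k\<in>{1..<j}. (1 - z ^ k) * (1 - z ^ (j - k)))"
      unfolding sum_negf[symmetric] by (rule sum.cong) (auto simp: algebra_simps simp flip: power_add)
    also have "\<dots> = - (2 * real j - (real j - 1) * (1 - z ^ j) - 2 * (1 - z ^ j) / (1 - z))"
      using sum_fragment_products[of z j] z that by simp
    also have "\<dots> = - 2 * real j + real j * (1 - z ^ j) + (2 / (1 - z) - 1) * (1 - z ^ j)"
      by (simp add: algebra_simps diff_divide_distrib)
    finally have "frag_term (\<lambda>j k. 1) ?g (\<lambda>j. r j t) j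
      = (- 2 * real j + real j * (1 - z ^ j) + (2 / (1 - z) - 1) * (1 - z ^ j)) * r j t"
      unfolding frag_term_def mult_1_right sum_distrib_right[symmetric] by simp
    then show ?thesis by (simp only: distrib_right mult.assoc)
  qed
  have "((\<lambda>j. - 2 * (real j * r j t) + ?p j + (2 / (1 - z) - 1) * (?g j * r j t)) has_sum
      (- 2 * m + slope z t + (2 / (1 - z) - 1) * gen z t)) {1..}"
    by (intro has_sum_add has_sum_cmult_right has_mass t slope_has_sum gen_has_sum z)
  then have "(frag_term (\<lambda>j k. 1) ?g (\<lambda>j. r j t) has_sum (- 2 * m + slope z t + (2 / (1 - z) - 1) * gen z t)) {1..}"
    by (rule has_sum_cong[THEN iffD2, rotated]) (rule frag)
  then have 2: "(\<Sum>\<^sub>\<infinity>j\<in>{1..}. frag_term (\<lambda>j k. 1) ?g (\<lambda>j. r j t) j) = - 2 * m + slope z t + (2 / (1 - z) - 1) * gen z t"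
    by (rule infsumI)
  have "weak_rhs_inf ?g (\<lambda>j. r j t)
     = - (slope z t)\<^sup>2 / 2 - slope z t / 2 + m - (1 / (1 - z) - 1/2) * gen z t"
    unfolding weak_rhs_inf_def 1 2 by (simp add: algebra_simps)
  with has_derivative[OF bnd t] show ?thesis
    unfolding gen_def[abs_def] by simp
qed

text \<open>Powers satisfy \<open>|w ^ j - z ^ j| <= j * |z - w|\<close> on the unit interval, so
  the conserved mass is a Lipschitz constant for all times.\<close>

lemma gen_Lipschitz:
  assumes t: "t \<ge> 0" and z: "0 \<le> z" "z < 1" "0 \<le> w" "w < 1"
  shows "\<bar>gen z t - gen w t\<bar> \<le> m * \<bar>z - w\<bar>"
proof -
  have s: "((\<lambda>j. (1 - z ^ j) * r j t - (1 - w ^ j) * r j t) has_sum (gen z t - gen w t)) {1..}"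
    by (intro has_sum_diff gen_has_sum t z)
  have "norm (gen z t - gen w t) \<le> m * \<bar>z - w\<bar>"
  proof (rule norm_infsum_le[OF s has_sum_cmult_left[OF has_mass[OF t]]])
    fix j :: nat assume "j \<in> {1..}"
    then have r: "r j t \<ge> 0" using nonneg[of j t] t by simp
    have "\<bar>w ^ j - z ^ j\<bar> \<le> real j * \<bar>z - w\<bar>"
      using norm_power_diff[of w z j] z by (simp add: abs_minus_commute)
    then have "\<bar>w ^ j - z ^ j\<bar> * r j t \<le> real j * \<bar>z - w\<bar> * r j t" by (rule mult_right_mono[OF _ r])
    moreover have "(1 - z ^ j) * r j t - (1 - w ^ j) * r j t = (w ^ j - z ^ j) * r j t"
      by (simp add: algebra_simps)
    ultimately show "norm ((1 - z ^ j) * r j t - (1 - w ^ j) * r j t) \<le> real j * r j t * \<bar>z - w\<bar>"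
      using r by (simp add: abs_mult mult_ac)
  qed
  then show ?thesis by simp
qed

lemma gen_continuous:
  assumes "z0 < 1"
  shows "continuous_on ({0..z0} \<times> {0..T}) (\<lambda>(z, t). gen z t)"
proof (rule continuous_on_Times_Lipschitz[where L = m])
  fix z assume "z \<in> {0..z0}"
  then have z: "0 \<le> z" "z < 1" using assms by auto
  have "continuous_on {0..} (gen z)"
    by (rule DERIV_continuous_on) (use gen_has_derivative[OF _ z] in auto)
  then show "continuous_on {0..T} (gen z)" by (rule continuous_on_subset) auto
qed (use assms gen_Lipschitz in auto)

end

text \<open>At a positive maximum of the difference \<open>D\<close> the time derivative from the
  left is nonnegative. The equation makes it negative: the larger function has the larger slope
  there, and the damping coefficient \<open>1 / (1 - x) - 1/2\<close> is at least 1/2.\<close>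

lemma cf_flow_gen_le:
  assumes "cf_flow m r" "cf_flow m q" and init: "\<And>j. j \<ge> 1 \<Longrightarrow> r j 0 = q j 0"
    and t: "t \<ge> 0" and z: "0 \<le> z" "z < 1"
  shows "cf_flow.gen r z t \<le> cf_flow.gen q z t"
proof (rule ccontr)
  interpret R: cf_flow m r by fact
  interpret Q: cf_flow m q by fact
  define D where "D z t = R.gen z t - Q.gen z t" for z t
  assume "\<not> R.gen z t \<le> Q.gen z t"
  then have D0: "D z t > 0" by (simp add: D_def)
  have "continuous_on ({0..z} \<times> {0..t}) (\<lambda>p. (\<lambda>(z, t). R.gen z t) p - (\<lambda>(z, t). Q.gen z t) p)"
    by (intro continuous_on_diff R.gen_continuous Q.gen_continuous z)
  then have "continuous_on ({0..z} \<times> {0..t}) (\<lambda>(z, t). D z t)"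
    by (simp add: D_def case_prod_beta')
  moreover have "compact ({0..z} \<times> {0..t})" "{0..z} \<times> {0..t} \<noteq> {}"
    using z t by (auto intro: compact_Times)
  ultimately obtain p where p: "p \<in> {0..z} \<times> {0..t}"
    and pmax: "\<And>y. y \<in> {0..z} \<times> {0..t} \<Longrightarrow> (\<lambda>(z, t). D z t) y \<le> (\<lambda>(z, t). D z t) p"
    using continuous_attains_sup by metis
  obtain x s where [simp]: "p = (x, s)" by (cases p)
  have xs: "0 \<le> x" "x \<le> z" "x < 1" "0 \<le> s" "s \<le> t" using p z by auto
  have max: "D y v \<le> D x s" if "0 \<le> y" "y \<le> z" "0 \<le> v" "v \<le> t" for y v
    using pmax[of "(y, v)"] that by auto
  have Dpos: "D x s > 0" using max[of z t] D0 z t by simp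
  have "R.gen x 0 = Q.gen x 0"
    unfolding R.gen_def Q.gen_def by (rule infsum_cong) (use init in auto)
  then have "D x 0 = 0" by (simp add: D_def)
  with Dpos have s0: "s > 0" using xs by (cases "s = 0") auto
  define d where "d j = r j s - q j s" for j
  let ?P = "R.slope x s" and ?Q = "Q.slope x s"
  \<comment> \<open>The slopes differ by \<open>x \<partial>D/\<partial>z\<close>, which is nonnegative even if the maximum lies on the edge \<open>x = z\<close>.\<close>
  have slope_diff: "?P - ?Q \<ge> 0"
  proof (cases "x = 0")
    \<comment> \<open>No point lies to the left of \<open>x = 0\<close>, but there both slopes equal
      the common mass.\<close>
    case True
    have "R.slope 0 s = m" "Q.slope 0 s = m"
      by (simp_all add: R.slope_0 Q.slope_0 xs)
    then show ?thesis using True by simp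
  next
    case False
    then have x0: "x > 0" using xs by simp
    define c where "c n = (if n = 0 then 0 else d n)" for n
    have sumd: "((\<lambda>j. (1 - y ^ j) * d j) has_sum D y s) {1..}" if "0 \<le> y" "y < 1" for y
      using has_sum_diff[OF R.gen_has_sum[OF xs(4) that] Q.gen_has_sum[OF xs(4) that]]
      by (simp add: D_def d_def right_diff_distrib)
    \<comment> \<open>At \<open>y = 0\<close> the weight \<open>1 - y ^ j\<close> is 1 for every
      \<open>j >= 1\<close>, so \<open>D 0 s\<close> is the plain sum of \<open>d\<close>.\<close>
    have d1: "(d has_sum D 0 s) {1..}"
      using sumd[OF order.refl zero_less_one] by (rule has_sum_cong[THEN iffD1, rotated]) auto
    have Dser: "D y s = D 0 s - (\<Sum>n. c n * y ^ n)" if y: "0 \<le> y" "y < 1" for y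
    proof -
      have "((\<lambda>j. d j * y ^ j) has_sum (D 0 s - D y s)) {1..}"
        using has_sum_diff[OF d1 sumd[OF y]] by (simp add: algebra_simps)
      from sums_unique[OF has_sum_imp_sums_from_1(1)[OF this]]
      have "D 0 s - D y s = (\<Sum>n. c n * y ^ n)"
        by (simp add: c_def if_distrib if_distribR cong: if_cong)
      then show ?thesis by simp
    qed
    have csum: "summable c"
      using sums_summable[OF has_sum_imp_sums_from_1(1)[OF d1]] by (simp add: c_def[abs_def])
    have "DERIV (\<lambda>y. \<Sum>n. c n * y ^ n) x :> (\<Sum>n. diffs c n * x ^ n)"
      by (rule termdiffs_strong[where K = 1]) (use csum xs in auto)
    moreover have "(\<Sum>n. diffs c n * x ^ n) = - (?P - ?Q) / x"
    proof -
      \<comment> \<open>Mass minus slope is the sum of \<open>j * x ^ j * r j s\<close>. Subtracting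
        the two solutions leaves \<open>x\<close> times the derived series of
        \<open>d\<close>.\<close>
      have "((\<lambda>j. (real j * r j s - (real j * (1 - x ^ j)) * r j s) - (real j * q j s - (real j * (1 - x ^ j)) * q j s))
          has_sum ((m - ?P) - (m - ?Q))) {1..}"
        by (intro has_sum_diff R.has_mass Q.has_mass R.slope_has_sum Q.slope_has_sum xs)
      moreover have "(m - ?P) - (m - ?Q) = - (?P - ?Q)" by simp
      ultimately have "((\<lambda>j. (real j * r j s - (real j * (1 - x ^ j)) * r j s) - (real j * q j s - (real j * (1 - x ^ j)) * q j s))
          has_sum - (?P - ?Q)) {1..}"
        by (simp only:)
      then have "((\<lambda>j. x * (real j * d j * x ^ (j - 1))) has_sum - (?P - ?Q)) {1..}"
        by (rule has_sum_cong[THEN iffD1, rotated]) 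
          (auto simp: d_def algebra_simps power_eq_if)
      from has_sum_cmult_right[OF this, of "1 / x"]
      have "((\<lambda>j. real j * d j * x ^ (j - 1)) has_sum - (?P - ?Q) / x) {1..}"
        using x0 by simp
      from sums_unique[OF has_sum_imp_sums_from_1(2)[OF this]]
      show ?thesis by (simp add: diffs_def c_def)
    qed
    ultimately have "DERIV (\<lambda>y. \<Sum>n. c n * y ^ n) x :> - (?P - ?Q) / x" by simp
    from DERIV_diff[OF DERIV_const[of "D 0 s"] this]
    have "DERIV (\<lambda>y. D 0 s - (\<Sum>n. c n * y ^ n)) x :> (?P - ?Q) / x"
      by (simp add: diff_divide_distrib)
    then have "((\<lambda>y. D 0 s - (\<Sum>n. c n * y ^ n)) has_real_derivative (?P - ?Q) / x) (at x within {0..})"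
      by (auto intro: has_field_derivative_at_within)
    then have "(?P - ?Q) / x \<ge> 0"
    proof (rule derivative_nonneg_at_left_max[OF _ x0])
      fix y assume "0 \<le> y" "y \<le> x"
      then show "D 0 s - (\<Sum>n. c n * y ^ n) \<le> D 0 s - (\<Sum>n. c n * x ^ n)"
        using Dser[of y] Dser[of x] max[of y s] xs by simp
    qed
    then show ?thesis using x0 by (simp add: zero_le_divide_iff)
  qed
  define L where "L = (- ?P\<^sup>2 / 2 - ?P / 2 + m - (1 / (1 - x) - 1/2) * R.gen x s)
     - (- ?Q\<^sup>2 / 2 - ?Q / 2 + m - (1 / (1 - x) - 1/2) * Q.gen x s)"
  have "(D x has_real_derivative L) (at s within {0..})"
    unfolding L_def D_def[abs_def] by (intro DERIV_diff R.gen_has_derivative Q.gen_has_derivative xs)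
  then have "L \<ge> 0"
    by (rule derivative_nonneg_at_left_max[OF _ s0]) (use max xs in auto)
  \<comment> \<open>Equal masses cancel, and the quadratic and linear slope terms factor
    together.\<close>
  moreover have "L = - ((?P - ?Q) * (?P + ?Q + 1)) / 2 - (1 / (1 - x) - 1/2) * D x s"
    by (simp add: L_def D_def power2_eq_square algebra_simps diff_divide_distrib add_divide_distrib)
  moreover have "(?P - ?Q) * (?P + ?Q + 1) \<ge> 0"
    using slope_diff R.slope_nonneg[of s x] Q.slope_nonneg[of s x] xs by (intro mult_nonneg_nonneg) auto
  moreover have "(1 / (1 - x) - 1/2) * D x s > 0"
  proof (rule mult_pos_pos[OF _ Dpos])
    have "1 / (1 - x) \<ge> 1" using xs by simp
    then show "1 / (1 - x) - 1/2 > 0" by linarith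
  qed
  ultimately show False by linarith
qed

text \<open>Comparison in both directions makes the generating functions equal on the unit interval,
  and the power series then determines each component.\<close>

lemma cf_flow_unique:
  assumes r: "cf_flow m r" and q: "cf_flow m q" and init: "\<And>j. j \<ge> 1 \<Longrightarrow> r j 0 = q j 0"
    and t: "t \<ge> 0" and j: "j \<ge> 1"
  shows "r j t = q j t"
proof -
  interpret R: cf_flow m r by fact
  interpret Q: cf_flow m q by fact
  define d where "d j = r j t - q j t" for j
  have eq: "R.gen z t = Q.gen z t" if "0 \<le> z" "z < 1" for z
    using cf_flow_gen_le[OF r q init t that] cf_flow_gen_le[OF q r init[symmetric] t that] by simp
  have sumd: "((\<lambda>j. (1 - y ^ j) * d j) has_sum 0) {1..}" if "0 \<le> y" "y < 1" for y
    using has_sum_diff[OF R.gen_has_sum[OF t that] Q.gen_has_sum[OF t that]] eq[OF that]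
    by (simp add: d_def right_diff_distrib)
  have d1: "(d has_sum 0) {1..}"
    using sumd[OF order.refl zero_less_one] by (rule has_sum_cong[THEN iffD1, rotated]) auto
  define c where "c n = (if n = 0 then 0 else d n)" for n
  have "c j = 0"
  proof (rule powser_eq_0_imp_coeff_0)
    show "summable c"
      using sums_summable[OF has_sum_imp_sums_from_1(1)[OF d1]] by (simp add: c_def[abs_def])
    fix z :: real assume z: "0 < z" "z < 1"
    have "((\<lambda>j. d j * z ^ j) has_sum (0 - 0)) {1..}"
      using has_sum_diff[OF d1 sumd[of z]] z by (simp add: algebra_simps)
    from sums_unique[OF has_sum_imp_sums_from_1(1)[OF this]]
    show "(\<Sum>n. c n * z ^ n) = 0"
      by (simp add: c_def if_distrib if_distribR cong: if_cong)
  qed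
  then show ?thesis using j by (simp add: c_def d_def)
qed

section \<open>Existence and uniqueness\<close>

lemma mult_kernel_eq: "mult_kernel = (\<lambda>j k. real j * real k)"
  by (simp add: mult_kernel_def fun_eq_iff)

lemma bounded_imageE:
  fixes g :: "nat \<Rightarrow> real"
  assumes "bounded (g ` {1..})"
  obtains B where "\<And>i. i \<ge> 1 \<Longrightarrow> \<bar>g i\<bar> \<le> B"
  using assms unfolding bounded_iff by auto

lemma cf_flow_of_solution:
  assumes sol: "cf_solution (\<lambda>j k. real j * real k) (\<lambda>j k. 1) \<rho>0 \<rho>" and mc: "mass_conserving \<rho>0 \<rho>"
  shows "cf_flow (moment 1 \<rho>0) (\<lambda>j t. \<rho> (j, t))"
proof
  fix j :: nat and t :: real assume "j \<ge> 1" "t \<ge> 0"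
  then show "\<rho> (j, t) \<ge> 0"
    using sol unfolding cf_solution_def by (auto simp: PiE_iff)
next
  fix t :: real assume "t \<ge> 0"
  then have "finite_moment 1 (\<lambda>j. \<rho> (j, t))" "moment 1 (\<lambda>j. \<rho> (j, t)) = moment 1 \<rho>0"
    using mc by (auto simp: mass_conserving_def)
  then show "((\<lambda>j. real j * \<rho> (j, t)) has_sum moment 1 \<rho>0) {1..}"
    unfolding finite_moment_def moment_def by (simp add: has_sum_iff)
next
  fix g :: "nat \<Rightarrow> real" and t :: real assume "bounded (g ` {1..})" "t \<ge> 0"
  then show "((\<lambda>s. \<Sum>\<^sub>\<infinity>j\<in>{1..}. g j * \<rho> (j, s)) has_real_derivative weak_rhs_inf g (\<lambda>j. \<rho> (j, t))) (at t within {0..})"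
    using sol unfolding cf_solution_def weak_rhs_inf_def mult_kernel_eq by blast
qed

lemma solution_unique:
  assumes "cf_solution (\<lambda>j k. real j * real k) (\<lambda>j k. 1) \<rho>0 \<rho>" "mass_conserving \<rho>0 \<rho>"
    and "cf_solution (\<lambda>j k. real j * real k) (\<lambda>j k. 1) \<rho>0 \<sigma>" "mass_conserving \<rho>0 \<sigma>"
  shows "\<rho> = \<sigma>"
proof (rule PiE_ext)
  show "\<rho> \<in> {1..} \<times> {0..} \<rightarrow>\<^sub>E {0..}" "\<sigma> \<in> {1..} \<times> {0..} \<rightarrow>\<^sub>E {0..}"
    using assms by (simp_all add: cf_solution_def)
  fix p :: "nat \<times> real" assume p: "p \<in> {1..} \<times> {0..}"
  obtain j t where [simp]: "p = (j, t)" by (cases p)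
  have "\<rho> (j, t) = \<sigma> (j, t)"
    by (rule cf_flow_unique[OF cf_flow_of_solution[OF assms(1,2)] cf_flow_of_solution[OF assms(3,4)]])
      (use assms p in \<open>auto simp: cf_solution_def\<close>)
  then show "\<rho> p = \<sigma> p" by simp
qed

text \<open>The restriction supplies the extensionality that \<open>cf_solution\<close> demands.
  Every series and derivative carries over, since only sizes \<open>j >= 1\<close> and times
  \<open>t >= 0\<close> enter them.\<close>

lemma (in cf_limit) solution:
  defines "\<rho> \<equiv> restrict (\<lambda>(j, t). r j t) ({1..} \<times> {0..})"
  shows "cf_solution (\<lambda>j k. real j * real k) (\<lambda>j k. 1) \<rho>0 \<rho>" "mass_conserving \<rho>0 \<rho>"
proof -
  have eq: "\<rho> (j, t) = r j t" if "j \<in> {1..}" "t \<ge> 0" for j t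
    using that by (simp add: \<rho>_def)
  show "mass_conserving \<rho>0 \<rho>"
    unfolding mass_conserving_def
  proof (intro allI impI)
    fix t :: real assume t: "t \<ge> 0"
    have "((\<lambda>j. real j ^ 1 * \<rho> (j, t)) has_sum mass) {1..}"
      using r_has_mass[OF t] by (rule has_sum_cong[THEN iffD1, rotated]) (use eq t in auto)
    then show "finite_moment 1 (\<lambda>j. \<rho> (j, t)) \<and> moment 1 (\<lambda>j. \<rho> (j, t)) = moment 1 \<rho>0"
      by (simp add: finite_moment_def moment_def mass_def has_sum_iff)
  qed
  show "cf_solution (\<lambda>j k. real j * real k) (\<lambda>j k. 1) \<rho>0 \<rho>"
    unfolding cf_solution_def
  proof (intro conjI allI impI)
    show "\<rho> \<in> {1..} \<times> {0..} \<rightarrow>\<^sub>E {0..}"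
      by (auto simp: \<rho>_def r_nonneg)
    show "\<rho> (j, 0) = \<rho>0 j" if "j \<ge> 1" for j
      using that eq r_init by simp
  next
    fix g :: "nat \<Rightarrow> real" and t :: real assume g: "bounded (g ` {1..})" and t: "t \<ge> 0"
    obtain B where B: "\<And>i. i \<ge> 1 \<Longrightarrow> \<bar>g i\<bar> \<le> B" by (rule bounded_imageE[OF g]) (rule that)
    have sum_eq: "(\<lambda>j. g j * \<rho> (j, s)) summable_on {1..} \<longleftrightarrow> (\<lambda>j. g j * r j s) summable_on {1..}"
      "(\<Sum>\<^sub>\<infinity>j\<in>{1..}. g j * \<rho> (j, s)) = (\<Sum>\<^sub>\<infinity>j\<in>{1..}. g j * r j s)" if "s \<ge> 0" for s
      by (intro summable_on_cong infsum_cong; use eq that in simp)+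
    have coag_eq: "coag_term (\<lambda>j k. real j * real k) g (\<lambda>i. \<rho> (i, t)) j k = coag_term mult_kernel g (\<lambda>i. r i t) j k"
      if "j \<in> {1..}" "k \<in> {1..}" for j k
      using that eq t by (simp add: coag_term_def mult_kernel_eq)
    have frag_eq: "frag_term (\<lambda>j k. 1) g (\<lambda>i. \<rho> (i, t)) j = frag_term (\<lambda>j k. 1) g (\<lambda>i. r i t) j"
      if "j \<in> {1..}" for j
      using that eq t by (simp add: frag_term_def)
    have nn: "\<And>i. i \<ge> 1 \<Longrightarrow> r i t \<ge> 0" using r_nonneg[OF t] .
    note M = has_sum_imp_summable[OF r_has_mass[OF t]]
    have inf: "(\<lambda>(j, k). coag_term mult_kernel g (\<lambda>i. r i t) j k) summable_on {1..} \<times> {1..}"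
      and inf': "frag_term (\<lambda>j k. 1) g (\<lambda>i. r i t) summable_on {1..}"
      using weak_rhs_inf_head_approx(1,2)[where g = g and B = B and f = "\<lambda>i. r i t"] B nn M by blast+
    show "(\<lambda>j. g j * \<rho> (j, t)) summable_on {1..}"
      using r_weighted(1)[where g = g and B = B, OF B t] by (simp only: sum_eq t)
    show "(\<lambda>(j, k). coag_term (\<lambda>j k. real j * real k) g (\<lambda>i. \<rho> (i, t)) j k) summable_on {1..} \<times> {1..}"
      using inf
      by (rule summable_on_cong[THEN iffD2, rotated]) (use coag_eq in auto)
    show "frag_term (\<lambda>j k. 1) g (\<lambda>i. \<rho> (i, t)) summable_on {1..}"
      using inf'
      by (rule summable_on_cong[THEN iffD2, rotated]) (rule frag_eq)
    have "(1/2) * (\<Sum>\<^sub>\<infinity>j\<in>{1..}. \<Sum>\<^sub>\<infinity>k\<in>{1..}. coag_term (\<lambda>j k. real j * real k) g (\<lambda>i. \<rho> (i, t)) j k)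
        - (1/2) * (\<Sum>\<^sub>\<infinity>j\<in>{1..}. frag_term (\<lambda>j k. 1) g (\<lambda>i. \<rho> (i, t)) j) = weak_rhs_inf g (\<lambda>i. r i t)"
      unfolding weak_rhs_inf_def
      by (intro arg_cong2[where f = "(-)"] arg_cong2[where f = "(*)"] refl infsum_cong coag_eq frag_eq)
    moreover have "((\<lambda>s. \<Sum>\<^sub>\<infinity>j\<in>{1..}. g j * \<rho> (j, s)) has_real_derivative weak_rhs_inf g (\<lambda>i. r i t)) (at t within {0..})"
      by (rule has_field_derivative_transform_within[OF weighted_has_derivative[where g = g and B = B], where d = 1])
        (use B t sum_eq(2) in auto)
    ultimately show "((\<lambda>s. \<Sum>\<^sub>\<infinity>j\<in>{1..}. g j * \<rho> (j, s)) has_real_derivative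
        (1/2) * (\<Sum>\<^sub>\<infinity>j\<in>{1..}. \<Sum>\<^sub>\<infinity>k\<in>{1..}. coag_term (\<lambda>j k. real j * real k) g (\<lambda>i. \<rho> (i, t)) j k)
        - (1/2) * (\<Sum>\<^sub>\<infinity>j\<in>{1..}. frag_term (\<lambda>j k. 1) g (\<lambda>i. \<rho> (i, t)) j)) (at t within {0..})"
      by (simp only:)
  qed
qed

theorem theorem1p3:
  fixes \<rho>0 :: "nat \<Rightarrow> real" and m :: real
  assumes "\<rho>0 \<in> {1..} \<rightarrow> {0..}"
    and "finite_moment 1 \<rho>0" and "moment 1 \<rho>0 = m" and "m \<in> {0<..<1/2}"
    and "finite_moment 2 \<rho>0"
  shows "\<exists>!\<rho>. cf_solution (\<lambda>j k. real j * real k) (\<lambda>j k. 1) \<rho>0 \<rho> \<and> mass_conserving \<rho>0 \<rho>"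
proof (rule ex_ex1I)
  interpret cf_data \<rho>0
    by unfold_locales (use assms in \<open>auto simp: finite_moment_def moment_def\<close>)
  obtain K r where K: "\<And>n. K n \<ge> Suc n"
    and r: "\<And>t j. t \<ge> 0 \<Longrightarrow> (\<lambda>n. scheme (K n) (step_at (K n) t) j) \<longlonglongrightarrow> r j t"
    by (rule scheme_subsequence) (rule that)
  interpret cf_limit \<rho>0 K r by unfold_locales (fact K r)+
  show "\<exists>\<rho>. cf_solution (\<lambda>j k. real j * real k) (\<lambda>j k. 1) \<rho>0 \<rho> \<and> mass_conserving \<rho>0 \<rho>"
    using solution by blast
qed (use solution_unique in blast)

end
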